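(* For every integer $d\ge1$ and every $N\ge1$ we have \[ \mathfrak{S}_{\mathbb{T}^d}(N)\le \mathfrak{S}_{\mathbb{R}^d}(N+1) \quad\text{and}\quad \mathfrak{M}_{\mathbb{T}^d}(N)\le \mathfrak{M}_{\mathbb{R}^d}(N+1). \]
   Context: A weight is a nonnegative locally integrable function; X-ray transforms below take values in $[0,\infty]$, and $0\cdot\infty=0$. "Least constant" means the infimum of admissible constants in $[0,\infty]$. Euclidean setting. For $u_0\in \mathrm{L}^2(\mathbb{R}^d)$ with compactly supported Fourier transform put \[ u(x,t)=\int_{\mathbb{R}^d}\widehat{u_0}(\xi) e^{2\pi i(x\cdot \xi+t|\xi|^2)}\,\mathrm{d}\xi,\quad (x,t)\in\mathbb{R}^d\times\mathbb{R}, \] and for a weight $w$ on $\mathbb{R}^d\times\mathbb{R}$ put $\rho^{\ast}w(x,v)=\int_{\mathbb{R}}w(x-2tv,t)\,\mathrm{d}t$ for $x,v\in\mathbb{R}^d$. For $N\ge1$, $\mathfrak{S}_{\mathbb{R}^d}(N)$ is the least constant $C$ such that \[ \int_0^1\int_{\mathbb{R}^d}|u(x,t)|^2w(x,t)\,\mathrm{d}x\,\mathrm{d}t \le C\int_{\mathbb{R}^d}|\widehat{u_0}(v)|^2\sup_{x\in\mathbb{R}^d}\rho^{\ast}w(x,v)\,\mathrm{d}v, \] and $\mathfrak{M}_{\mathbb{R}^d}(N)$ is the least constant $C$ such that \[ \int_0^1\int_{\mathbb{R}^d}|u(x,t)|^2w(x,t)\,\mathrm{d}x\,\mathrm{d}t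 \le C\sup_{x\in\mathbb{R}^d,\ v\in\operatorname{supp}\widehat{u_0}}\rho^{\ast}w(x,v)\ \|u_0\|_{\mathrm{L}^2(\mathbb{R}^d)}^2, \] in each case for all weights $w$ on $\mathbb{R}^d\times\mathbb{R}$ and all $u_0\in\mathrm{L}^2(\mathbb{R}^d)$ with $\operatorname{supp}\widehat{u_0}\subseteq[-N,N]^d$. Periodic setting. Let $\mathbb{T}^d=\mathbb{R}^d/\mathbb{Z}^d$. For a trigonometric polynomial $u_0$ on $\mathbb{T}^d$ put \[ u(x,t)=\sum_{k\in\mathbb{Z}^d}\widehat{u_0}(k)e^{2\pi i(x\cdot k+t|k|^2)},\quad (x,t)\in\mathbb{T}^d\times\mathbb{T}, \] and for a weight $w$ on $\mathbb{T}^d\times\mathbb{T}$ put $\rho^{\ast}_{\mathbb{Z}^d}w(x,k)=\int_0^1 w(x-2tk,t)\,\mathrm{d}t$ for $(x,k)\in\mathbb{T}^d\times\mathbb{Z}^d$. For $N\ge1$, $\mathfrak{S}_{\mathbb{T}^d}(N)$ is the least constant $C$ such that \[ \int_{\mathbb{T}} \int_{\mathbb{T}^d} |u(x,t)|^2w(x,t)\,\mathrm{d}x\,\mathrm{d}t\leq C\sum_{k\in\mathbb{Z}^d}|\widehat{u_0}(k)|^2\sup_{x\in\mathbb{T}^d}\rho^{\ast}_{\mathbb{Z}^{d}}w(x,k), \] and $\mathfrak{M}_{\mathbb{T}^d}(N)$ is the least constant $C$ such that \[ \int_{\mathbb{T}} \int_{\mathbb{T}^d} |u(x,t)|^2w(x,t)\,\mathrm{d}x\,\mathrm{d}t\leq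 C \sup_{x\in\mathbb{T}^d,\ k\in\operatorname{supp}\widehat{u_0}}\rho^{\ast}_{\mathbb{Z}^{d}}w(x,k) \,\|u_0\|_{\mathrm{L}^2(\mathbb{T}^d)}^2, \] in each case for all weights $w$ on $\mathbb{T}^d\times\mathbb{T}$ and all trigonometric polynomials $u_0$ with $\operatorname{supp}\widehat{u_0}\subseteq\mathbb{Z}^d\cap[-N,N]^d$. *)

theory Defs
  imports "HOL-Analysis.Analysis"
begin

text \<open>
  \<open>\<real>\<^sup>d\<close> is \<^typ>\<open>real ^ 'n\<close> and \<open>\<int>\<^sup>d\<close> is \<^typ>\<open>int ^ 'n\<close>, with \<open>d = CARD('n) \<ge> 1\<close>.
  A function on \<open>\<real>\<^sup>d / \<int>\<^sup>d\<close> is a \<open>\<int>\<^sup>d\<close>-periodic function on \<open>\<real>\<^sup>d\<close>, and integrals over the torus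
  are integrals over the unit cube. Quantities in \<open>[0,\<infinity>]\<close> are of type \<^typ>\<open>ennreal\<close>,
  where \<open>0 * \<infinity> = 0\<close>, \<open>Inf {} = \<infinity>\<close> and \<open>Sup {} = 0\<close>.
\<close>

section \<open>Weights\<close>

text \<open>
  Weights are everywhere-defined Borel functions, so that they can be integrated along every line.
  For a Borel weight the supremum over \<open>x\<close> of its X-ray transform is Lebesgue (though perhaps not
  Borel) measurable in \<open>v\<close>, and its \<^const>\<open>nn_integral\<close> with respect to \<^const>\<open>lborel\<close>, a supremum
  over Borel simple minorants, is then its Lebesgue integral.
\<close>

definition weight :: "('a::euclidean_space \<Rightarrow> real) \<Rightarrow> bool" where
  "weight w \<longleftrightarrow> w \<in> borel_measurable borel \<and> (\<forall>z. 0 \<le> w z) \<and>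
     (\<forall>K. compact K \<longrightarrow> set_integrable lborel K w)"

definition vec_of_int :: "int ^ 'n \<Rightarrow> real ^ 'n" where
  "vec_of_int k = (\<chi> i. real_of_int (k $ i))"

definition torus_weight :: "((real ^ 'n) \<times> real \<Rightarrow> real) \<Rightarrow> bool" where
  "torus_weight w \<longleftrightarrow> weight w \<and>
     (\<forall>x t k m. w (x + vec_of_int k, t + real_of_int m) = w (x, t))"

definition cube :: "real \<Rightarrow> (real ^ 'n) set" where
  "cube N = {v. \<forall>i. v $ i \<in> {-N..N}}"


section \<open>The Euclidean setting\<close>

definition norm2_sq :: "(real ^ 'n \<Rightarrow> complex) \<Rightarrow> ennreal" where
  "norm2_sq f = (\<integral>\<^sup>+x. ennreal ((cmod (f x))\<^sup>2) \<partial>lborel)"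

definition L2 :: "(real ^ 'n \<Rightarrow> complex) set" where
  "L2 = {f \<in> borel_measurable borel. norm2_sq f < \<infinity>}"

definition fourier_L1 :: "(real ^ 'n \<Rightarrow> complex) \<Rightarrow> real ^ 'n \<Rightarrow> complex" where
  "fourier_L1 f \<xi> = (LINT x|lborel. f x * cis (- (2 * pi * (x \<bullet> \<xi>))))"

text \<open>
  The Fourier transform on \<open>L\<^sup>2\<close>, as the extension by density and continuity from \<open>L\<^sup>1 \<inter> L\<^sup>2\<close>. Being
  determined only up to null sets, it is a relation: \<open>g\<close> is a representative of the transform
  of \<open>f\<close>. Everything below is invariant under the choice of \<open>g\<close>.
\<close>

definition has_fourier_transform ::
    "(real ^ 'n \<Rightarrow> complex) \<Rightarrow> (real ^ 'n \<Rightarrow> complex) \<Rightarrow> bool" where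
  "has_fourier_transform f g \<longleftrightarrow> f \<in> L2 \<and> g \<in> L2 \<and>
     (\<exists>F :: nat \<Rightarrow> real ^ 'n \<Rightarrow> complex.
        (\<forall>n. integrable lborel (F n) \<and> F n \<in> L2) \<and>
        (\<lambda>n. norm2_sq (\<lambda>x. F n x - f x)) \<longlonglongrightarrow> 0 \<and>
        (\<lambda>n. norm2_sq (\<lambda>\<xi>. fourier_L1 (F n) \<xi> - g \<xi>)) \<longlonglongrightarrow> 0)"

text \<open>Support of an almost-everywhere class: the complement of the largest open set on which
  \<open>g\<close> vanishes almost everywhere.\<close>

definition ess_supp :: "(real ^ 'n \<Rightarrow> complex) \<Rightarrow> (real ^ 'n) set" where
  "ess_supp g = - \<Union>{U. open U \<and> (AE x in lborel. x \<in> U \<longrightarrow> g x = 0)}"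

text \<open>The solution \<open>u(x,t)\<close>, in terms of the Fourier transform \<open>g\<close> of the initial datum.\<close>

definition solution :: "(real ^ 'n \<Rightarrow> complex) \<Rightarrow> real ^ 'n \<Rightarrow> real \<Rightarrow> complex" where
  "solution g x t = (LINT \<xi>|lborel. g \<xi> * cis (2 * pi * (x \<bullet> \<xi> + t * (norm \<xi>)\<^sup>2)))"

definition xray :: "((real ^ 'n) \<times> real \<Rightarrow> real) \<Rightarrow> real ^ 'n \<Rightarrow> real ^ 'n \<Rightarrow> ennreal" where
  "xray w x v = (\<integral>\<^sup>+t. ennreal (w (x - (2 * t) *\<^sub>R v, t)) \<partial>lborel)"

definition weighted_mass ::
    "(real ^ 'n \<Rightarrow> complex) \<Rightarrow> ((real ^ 'n) \<times> real \<Rightarrow> real) \<Rightarrow> ennreal" where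
  "weighted_mass g w =
     (\<integral>\<^sup>+t\<in>{0..1}. (\<integral>\<^sup>+x. ennreal ((cmod (solution g x t))\<^sup>2 * w (x, t)) \<partial>lborel) \<partial>lborel)"

definition stein_const :: "'n::finite itself \<Rightarrow> real \<Rightarrow> ennreal" where
  "stein_const d N = Inf {C. \<forall>(w :: (real ^ 'n) \<times> real \<Rightarrow> real) u\<^sub>0 g.
     weight w \<longrightarrow> has_fourier_transform u\<^sub>0 g \<longrightarrow> ess_supp g \<subseteq> cube N \<longrightarrow>
     weighted_mass g w
       \<le> C * (\<integral>\<^sup>+v. ennreal ((cmod (g v))\<^sup>2) * (SUP x. xray w x v) \<partial>lborel)}"

definition mizohata_const :: "'n::finite itself \<Rightarrow> real \<Rightarrow> ennreal" where
  "mizohata_const d N = Inf {C. \<forall>(w :: (real ^ 'n) \<times> real \<Rightarrow> real) u\<^sub>0 g.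
     weight w \<longrightarrow> has_fourier_transform u\<^sub>0 g \<longrightarrow> ess_supp g \<subseteq> cube N \<longrightarrow>
     weighted_mass g w
       \<le> C * (SUP (x, v) \<in> UNIV \<times> ess_supp g. xray w x v) * norm2_sq u\<^sub>0}"


section \<open>The periodic setting\<close>

definition trig_poly :: "(real ^ 'n \<Rightarrow> complex) \<Rightarrow> bool" where
  "trig_poly u\<^sub>0 \<longleftrightarrow> (\<exists>K a. finite K \<and>
     u\<^sub>0 = (\<lambda>x. \<Sum>k\<in>K. a k * cis (2 * pi * (x \<bullet> vec_of_int k))))"

definition fourier_coeff :: "(real ^ 'n \<Rightarrow> complex) \<Rightarrow> int ^ 'n \<Rightarrow> complex" where
  "fourier_coeff u\<^sub>0 k =
     (LINT x:cbox 0 1|lborel. u\<^sub>0 x * cis (- (2 * pi * (x \<bullet> vec_of_int k))))"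

definition fourier_supp :: "(real ^ 'n \<Rightarrow> complex) \<Rightarrow> (int ^ 'n) set" where
  "fourier_supp u\<^sub>0 = {k. fourier_coeff u\<^sub>0 k \<noteq> 0}"

definition torus_norm2_sq :: "(real ^ 'n \<Rightarrow> complex) \<Rightarrow> ennreal" where
  "torus_norm2_sq f = (\<integral>\<^sup>+x\<in>cbox 0 1. ennreal ((cmod (f x))\<^sup>2) \<partial>lborel)"

definition torus_solution :: "(real ^ 'n \<Rightarrow> complex) \<Rightarrow> real ^ 'n \<Rightarrow> real \<Rightarrow> complex" where
  "torus_solution u\<^sub>0 x t = (\<Sum>\<^sub>\<infinity>k. fourier_coeff u\<^sub>0 k *
     cis (2 * pi * (x \<bullet> vec_of_int k + t * (norm (vec_of_int k))\<^sup>2)))"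

definition torus_xray :: "((real ^ 'n) \<times> real \<Rightarrow> real) \<Rightarrow> real ^ 'n \<Rightarrow> int ^ 'n \<Rightarrow> ennreal" where
  "torus_xray w x k =
     (\<integral>\<^sup>+t\<in>{0..1}. ennreal (w (x - (2 * t) *\<^sub>R vec_of_int k, t)) \<partial>lborel)"

definition torus_weighted_mass ::
    "(real ^ 'n \<Rightarrow> complex) \<Rightarrow> ((real ^ 'n) \<times> real \<Rightarrow> real) \<Rightarrow> ennreal" where
  "torus_weighted_mass u\<^sub>0 w =
     (\<integral>\<^sup>+t\<in>{0..1}. (\<integral>\<^sup>+x\<in>cbox 0 1.
        ennreal ((cmod (torus_solution u\<^sub>0 x t))\<^sup>2 * w (x, t)) \<partial>lborel) \<partial>lborel)"

definition torus_stein_const :: "'n::finite itself \<Rightarrow> real \<Rightarrow> ennreal" where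
  "torus_stein_const d N = Inf {C. \<forall>(w :: (real ^ 'n) \<times> real \<Rightarrow> real) u\<^sub>0.
     torus_weight w \<longrightarrow> trig_poly u\<^sub>0 \<longrightarrow> vec_of_int ` fourier_supp u\<^sub>0 \<subseteq> cube N \<longrightarrow>
     torus_weighted_mass u\<^sub>0 w
       \<le> C * (\<Sum>\<^sub>\<infinity>k. ennreal ((cmod (fourier_coeff u\<^sub>0 k))\<^sup>2) * (SUP x. torus_xray w x k))}"

definition torus_mizohata_const :: "'n::finite itself \<Rightarrow> real \<Rightarrow> ennreal" where
  "torus_mizohata_const d N = Inf {C. \<forall>(w :: (real ^ 'n) \<times> real \<Rightarrow> real) u\<^sub>0.
     torus_weight w \<longrightarrow> trig_poly u\<^sub>0 \<longrightarrow> vec_of_int ` fourier_supp u\<^sub>0 \<subseteq> cube N \<longrightarrow>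
     torus_weighted_mass u\<^sub>0 w
       \<le> C * (SUP (x, k) \<in> UNIV \<times> fourier_supp u\<^sub>0. torus_xray w x k) * torus_norm2_sq u\<^sub>0}"

end

theory Submission
  imports Defs "HOL-Probability.Characteristic_Functions"
begin

text \<open>
  Each Euclidean admissible constant for \<open>N + 1\<close> is shown to be admissible on the torus for \<open>N\<close>, by
  testing the Euclidean inequality on wave packets that imitate a periodic solution.
  
  Let the periodic datum have Fourier coefficients \<open>a k\<close>, and let \<open>\<phi>\<close> be a continuous bump supported in the
  unit ball. The Euclidean datum with transform \<open>g \<xi> = (\<Sum>k. a k * \<phi> ((\<xi> - k) / \<epsilon>))\<close> has frequencies in
  \<open>cube (N + 1)\<close>, and its solution is, up to the factor \<open>\<epsilon> ^ d\<close> and for times in \<open>[0,1]\<close>, close to the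
  periodic solution multiplied by the slowly varying envelope \<open>\<Phi> (\<epsilon> x)\<close>, where \<open>\<Phi>\<close> is the inverse
  Fourier transform of \<open>\<phi>\<close> (\<open>solution_packets\<close>, \<open>envelope_tendsto\<close>). Take as Euclidean weight a periodic
  weight \<open>W\<close> restricted to times in \<open>[0,1]\<close>, and divide both sides of the inequality by \<open>\<epsilon> ^ d\<close>. On the left,
  decomposing the space into lattice cells separates the slow variable from the position in the cell,
  and the lower limit is at least \<open>\<parallel>\<Phi>\<parallel>\<^sup>2\<close> times the periodic mass. On the right, the packets are built from
  bumps that do not overlap and shrink to the lattice points, which gives \<open>\<parallel>\<phi>\<parallel>\<^sup>2\<close> times the periodic
  expression, provided that the X-ray transform of \<open>W\<close> at velocities near \<open>k\<close> is controlled by its values at \<open>k\<close>.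
  The two norms agree by Plancherel's theorem. This is \<open>poly_mass_le_of_packets\<close>.
  
  For a rough weight \<open>w\<close> that control fails: the supremum of its X-ray transform may jump as the velocity
  leaves the lattice. Therefore \<open>W\<close> is taken to be \<open>w\<close>, truncated and averaged in space against a kernel
  with Lipschitz logarithm. The averaged weight satisfies a Harnack inequality, so a change of velocity
  by \<open>\<epsilon>\<close> costs only a factor \<open>exp (c * \<epsilon>)\<close>, while at lattice velocities the supremum does not
  increase (\<open>xray_mollified_le\<close>). Finally the averaging is undone
  (\<open>poly_mass_le_liminf_mollified\<close>). Both limits are needed in one direction only and follow from
  Fatou's lemma.
  
  That \<open>g\<close> is the transform of an \<open>L\<^sup>2\<close> function, and Plancherel's identity for it, are obtained by
  Gaussian summation (\<open>has_fourier_transform_inverse_fourier\<close>, \<open>plancherel\<close>).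
\<close>

section \<open>Affine changes of variables and the Gaussian\<close>

lemma nn_integral_lborel_affine:
  fixes f :: "'a::euclidean_space \<Rightarrow> ennreal"
  assumes [measurable]: "f \<in> borel_measurable borel" and c: "c > 0"
  shows "(\<integral>\<^sup>+x. f x \<partial>lborel) = ennreal (c ^ DIM('a)) * (\<integral>\<^sup>+x. f (t + c *\<^sub>R x) \<partial>lborel)"
  using c by (subst lborel_affine[of c t])
    (auto simp: nn_integral_density nn_integral_distr nn_integral_cmult ennreal_power)

lemma nn_integral_lborel_shift:
  fixes f :: "'a::euclidean_space \<Rightarrow> ennreal"
  assumes "f \<in> borel_measurable borel"
  shows "(\<integral>\<^sup>+x. f (t + x) \<partial>lborel) = (\<integral>\<^sup>+x. f x \<partial>lborel)"
  using nn_integral_lborel_affine[OF assms, of 1 t] by simp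

lemma lborel_integral_affine:
  fixes f :: "'a::euclidean_space \<Rightarrow> 'b::{banach, second_countable_topology}"
  assumes [measurable]: "f \<in> borel_measurable borel" and c: "c > 0"
  shows "(LINT x|lborel. f x) = c ^ DIM('a) *\<^sub>R (LINT x|lborel. f (t + c *\<^sub>R x))"
  using c by (subst lborel_affine[of c t])
    (auto simp: integral_density integral_distr)

lemma lborel_integrable_affine:
  fixes f :: "'a::euclidean_space \<Rightarrow> 'b::{banach, second_countable_topology}"
  assumes f: "integrable lborel f" and c: "c > 0"
  shows "integrable lborel (\<lambda>x. f (t + c *\<^sub>R x))"
proof -
  have [measurable]: "f \<in> borel_measurable borel" using f by auto
  have "integrable (density (distr lborel borel (\<lambda>x. t + c *\<^sub>R x)) (\<lambda>_. \<bar>c\<bar>^DIM('a))) f"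
    using f c by (subst lborel_affine[symmetric]) auto
  then have "integrable lborel (\<lambda>x. c ^ DIM('a) *\<^sub>R f (t + c *\<^sub>R x))"
    using c by (auto simp: integrable_density integrable_distr_eq ennreal_power)
  then have "integrable lborel (\<lambda>x. (1 / c ^ DIM('a)) *\<^sub>R c ^ DIM('a) *\<^sub>R f (t + c *\<^sub>R x))"
    by (rule integrable_scaleR_right)
  then show ?thesis using c by simp
qed

lemma
  fixes f :: "'a::euclidean_space \<Rightarrow> real \<Rightarrow> 'b::{real_normed_field, banach, second_countable_topology}"
  assumes f: "\<And>b. b \<in> Basis \<Longrightarrow> integrable lborel (f b)"
  shows lborel_integrable_prod_Basis: "integrable lborel (\<lambda>x. \<Prod>b\<in>Basis. f b (x \<bullet> b))"
    and lborel_integral_prod_Basis: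
      "(LINT x|lborel. (\<Prod>b\<in>Basis. f b (x \<bullet> b))) = (\<Prod>b\<in>Basis. (LINT x|lborel. f b x))"
proof -
  interpret product_sigma_finite "\<lambda>_::'a. lborel :: real measure" ..
  have [measurable]: "f b \<in> borel_measurable borel" if "b \<in> Basis" for b
    using f[OF that] by auto
  have *: "(\<Prod>b\<in>Basis. f b ((\<Sum>b'\<in>Basis. x b' *\<^sub>R b') \<bullet> b)) = (\<Prod>b\<in>Basis. f b (x b))" for x
    by (intro prod.cong) auto
  show "integrable lborel (\<lambda>x. \<Prod>b\<in>Basis. f b (x \<bullet> b))"
    unfolding lborel_eq[where 'a='a]
    by (subst integrable_distr_eq) (auto simp: * intro!: product_integrable_prod f)
  show "(LINT x|lborel. (\<Prod>b\<in>Basis. f b (x \<bullet> b))) = (\<Prod>b\<in>Basis. (LINT x|lborel. f b x))"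
    unfolding lborel_eq[where 'a='a]
    by (subst integral_distr) (auto simp: * intro!: product_integral_prod f)
qed

lemma
  fixes s \<xi> :: real
  assumes s: "s > 0"
  shows integrable_gaussian_cis_real:
      "integrable lborel (\<lambda>x. of_real (exp (-(pi * s * x\<^sup>2))) * cis (2 * pi * (x * \<xi>)))"
    and integral_gaussian_cis_real:
      "(LINT x|lborel. of_real (exp (-(pi * s * x\<^sup>2))) * cis (2 * pi * (x * \<xi>)))
         = complex_of_real (exp (-(pi * \<xi>\<^sup>2 / s)) / sqrt s)"
proof -
  define c where "c = sqrt (2 * pi * s)"
  have c: "c > 0" "c\<^sup>2 = 2 * pi * s" using s by (auto simp: c_def)
  \<comment> \<open>\<open>x \<mapsto> c x\<close> turns the standard normal density into the Gaussian of the statement, and \<open>t\<close> is the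
    frequency that corresponds to \<open>\<xi>\<close>\<close>
  define t where "t = 2 * pi * \<xi> / c"
  let ?f = "\<lambda>x. std_normal_density x *\<^sub>R iexp (t * x)"
  have int: "integrable lborel ?f"
    using integrable_std_normal_moment[of 0]
    by (subst integrable_iff_bounded) (auto simp: integrable_iff_bounded)
  have val: "(LINT x|lborel. ?f x) = complex_of_real (exp (- (t\<^sup>2) / 2))"
    using fun_cong[OF char_std_normal_distribution, of t] unfolding char_def
    by (subst (asm) integral_density) (auto simp: normal_density_nonneg)
  have eq: "?f (0 + c *\<^sub>R x) = (1 / sqrt (2 * pi)) *\<^sub>R (of_real (exp (-(pi * s * x\<^sup>2))) * cis (2 * pi * (x * \<xi>)))" for x
  proof -
    have "(c * x)\<^sup>2 / 2 = pi * s * x\<^sup>2" using c by (simp add: power_mult_distrib)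
    moreover have "t * (c * x) = 2 * pi * (x * \<xi>)" using c by (simp add: t_def)
    then have "iexp (t * (c * x)) = cis (2 * pi * (x * \<xi>))"
      by (simp only: cis_conv_exp)
    ultimately show ?thesis
      by (simp add: std_normal_density_def scaleR_conv_of_real)
  qed
  have "integrable lborel (\<lambda>x. ?f (0 + c *\<^sub>R x))"
    by (rule lborel_integrable_affine[OF int c(1)])
  then have i2: "integrable lborel (\<lambda>x. (1 / sqrt (2 * pi)) *\<^sub>R (of_real (exp (-(pi * s * x\<^sup>2))) * cis (2 * pi * (x * \<xi>))))"
    unfolding eq .
  from integrable_scaleR_right[OF this, of "sqrt (2 * pi)"]
  show i3: "integrable lborel (\<lambda>x. of_real (exp (-(pi * s * x\<^sup>2))) * cis (2 * pi * (x * \<xi>)))"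
    by simp
  have "complex_of_real (exp (- (t\<^sup>2) / 2)) = c *\<^sub>R (LINT x|lborel. ?f (0 + c *\<^sub>R x))"
    using val lborel_integral_affine[of ?f c 0] c by simp
  also have "\<dots> = (c / sqrt (2 * pi)) *\<^sub>R (LINT x|lborel. of_real (exp (-(pi * s * x\<^sup>2))) * cis (2 * pi * (x * \<xi>)))"
    unfolding eq by (subst integral_scaleR_right) auto
  also have "c / sqrt (2 * pi) = sqrt s" by (simp add: c_def real_sqrt_mult)
  finally have "(LINT x|lborel. of_real (exp (-(pi * s * x\<^sup>2))) * cis (2 * pi * (x * \<xi>))) =
      (1 / sqrt s) *\<^sub>R complex_of_real (exp (- (t\<^sup>2) / 2))"
    using s by simp
  also have "- (t\<^sup>2) / 2 = -(pi * \<xi>\<^sup>2 / s)"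
    using c s by (simp add: t_def power_divide power_mult_distrib field_simps power2_eq_square)
  finally show "(LINT x|lborel. of_real (exp (-(pi * s * x\<^sup>2))) * cis (2 * pi * (x * \<xi>)))
         = complex_of_real (exp (-(pi * \<xi>\<^sup>2 / s)) / sqrt s)"
    by (simp add: scaleR_conv_of_real)
qed

lemma cis_sum: "finite A \<Longrightarrow> cis (\<Sum>a\<in>A. f a) = (\<Prod>a\<in>A. cis (f a))"
  by (induction A rule: finite_induct) (auto simp: cis_mult[symmetric])

lemma
  fixes \<xi> :: "'a::euclidean_space"
  assumes s: "s > 0"
  shows integrable_gaussian_cis:
      "integrable lborel (\<lambda>x::'a. of_real (exp (-(pi * s * (norm x)\<^sup>2))) * cis (2 * pi * (x \<bullet> \<xi>)))"
    and integral_gaussian_cis: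
      "(LINT x|lborel. of_real (exp (-(pi * s * (norm x)\<^sup>2))) * cis (2 * pi * (x \<bullet> \<xi>)))
         = complex_of_real (exp (-(pi * (norm \<xi>)\<^sup>2 / s)) / sqrt s ^ DIM('a))"
proof -
  let ?f = "\<lambda>b x. of_real (exp (-(pi * s * x\<^sup>2))) * cis (2 * pi * (x * (\<xi> \<bullet> b)))"
  have n: "(norm x)\<^sup>2 = (\<Sum>b\<in>Basis. (x \<bullet> b)\<^sup>2)" for x :: 'a
    unfolding power2_norm_eq_inner by (subst euclidean_inner) (simp add: power2_eq_square)
  have eq: "of_real (exp (-(pi * s * (norm x)\<^sup>2))) * cis (2 * pi * (x \<bullet> \<xi>)) = (\<Prod>b\<in>Basis. ?f b (x \<bullet> b))" for x
    unfolding n euclidean_inner[of x \<xi>]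
    by (simp add: sum_distrib_left sum_negf[symmetric] exp_sum cis_sum prod.distrib)
  show "integrable lborel (\<lambda>x::'a. of_real (exp (-(pi * s * (norm x)\<^sup>2))) * cis (2 * pi * (x \<bullet> \<xi>)))"
    unfolding eq by (rule lborel_integrable_prod_Basis[where f="?f"]) (rule integrable_gaussian_cis_real[OF s])
  have "(LINT x|lborel. of_real (exp (-(pi * s * (norm x)\<^sup>2))) * cis (2 * pi * (x \<bullet> \<xi>)))
      = (\<Prod>b\<in>Basis. complex_of_real (exp (-(pi * (\<xi> \<bullet> b)\<^sup>2 / s)) / sqrt s))"
    unfolding eq
    by (subst lborel_integral_prod_Basis[where f="?f"], rule integrable_gaussian_cis_real[OF s])
       (simp add: integral_gaussian_cis_real[OF s])
  also have "\<dots> = complex_of_real (exp (-(pi * (norm \<xi>)\<^sup>2 / s)) / sqrt s ^ DIM('a))"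
    unfolding n by (simp add: prod_dividef exp_sum sum_distrib_left sum_divide_distrib sum_negf[symmetric])
  finally show "(LINT x|lborel. of_real (exp (-(pi * s * (norm x)\<^sup>2))) * cis (2 * pi * (x \<bullet> \<xi>)))
         = complex_of_real (exp (-(pi * (norm \<xi>)\<^sup>2 / s)) / sqrt s ^ DIM('a))" .
qed

text \<open>
  The inverse Fourier transform of \<open>exp (- \<pi> s \<bar>x\<bar>\<^sup>2)\<close>: a probability density of width \<open>sqrt s\<close>.
\<close>
definition gauss_kernel :: "real \<Rightarrow> 'a::euclidean_space \<Rightarrow> real" where
  "gauss_kernel s z = exp (-(pi * (norm z)\<^sup>2 / s)) / sqrt s ^ DIM('a)"

lemma gauss_kernel_nonneg [simp]: "s > 0 \<Longrightarrow> gauss_kernel s z \<ge> 0"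
  by (simp add: gauss_kernel_def)

lemma gauss_kernel_measurable [measurable]: "gauss_kernel s \<in> borel_measurable borel"
  unfolding gauss_kernel_def[abs_def] by measurable

lemma gauss_kernel_minus: "gauss_kernel s (- z) = gauss_kernel s z"
  by (simp add: gauss_kernel_def)

lemma
  assumes s: "s > 0"
  shows integrable_gauss_kernel: "integrable lborel (gauss_kernel s :: 'a::euclidean_space \<Rightarrow> real)"
    and integral_gauss_kernel: "(LINT z|lborel. gauss_kernel s (z::'a)) = 1"
proof -
  have s': "1 / s > 0" using s by simp
  let ?g = "\<lambda>z::'a. exp (-(pi * (1 / s) * (norm z)\<^sup>2))"
  have i: "integrable lborel (\<lambda>z. complex_of_real (?g z))"
    using integrable_gaussian_cis[OF s', of "0::'a"] by simp
  then have i': "integrable lborel ?g" by (subst (asm) complex_of_real_integrable_eq)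
  have v: "complex_of_real (LINT z|lborel. ?g z) = complex_of_real (1 / sqrt (1 / s) ^ DIM('a))"
    using integral_gaussian_cis[OF s', of "0::'a"] by simp
  then have v': "(LINT z|lborel. ?g z) = sqrt s ^ DIM('a)"
    unfolding of_real_eq_iff by (simp add: real_sqrt_divide power_divide)
  have eq: "gauss_kernel s (z::'a) = ?g z / sqrt s ^ DIM('a)" for z
    by (simp add: gauss_kernel_def)
  show "integrable lborel (gauss_kernel s :: 'a \<Rightarrow> real)"
    unfolding eq[abs_def] using i' by simp
  show "(LINT z|lborel. gauss_kernel s (z::'a)) = 1"
    unfolding eq[abs_def] using v' s by simp
qed

lemma
  fixes a :: "'a::euclidean_space"
  assumes s: "s > 0"
  shows integrable_gauss_kernel_shift: "integrable lborel (\<lambda>\<eta>. gauss_kernel s (\<eta> - a))"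
    and integral_gauss_kernel_shift: "(LINT \<eta>|lborel. gauss_kernel s (\<eta> - a)) = 1"
proof -
  show "integrable lborel (\<lambda>\<eta>. gauss_kernel s (\<eta> - a))"
    using lborel_integrable_affine[OF integrable_gauss_kernel[OF s], of 1 "-a"] by simp
  show "(LINT \<eta>|lborel. gauss_kernel s (\<eta> - a)) = 1"
    using lborel_integral_affine[of "gauss_kernel s" 1 "-a"] integral_gauss_kernel[OF s, where 'a='a] by simp
qed

text \<open>
  Fubini's theorem moves an oscillating kernel from one integrable factor to the other. Used with
  \<open>\<theta> x y = 2 \<pi> (x \<bullet> y)\<close> it identifies the transform of a damped inverse transform, and with the
  opposite sign it computes the energy of the latter.
\<close>
lemma multiplication_formula:
  fixes F G :: "'a::euclidean_space \<Rightarrow> complex" and \<theta> :: "'a \<Rightarrow> 'a \<Rightarrow> real"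
  assumes F: "integrable lborel F" and G: "integrable lborel G"
    and [measurable]: "case_prod \<theta> \<in> borel_measurable (borel \<Otimes>\<^sub>M borel)"
  shows "(LINT x|lborel. F x * (LINT y|lborel. G y * cis (\<theta> x y)))
       = (LINT y|lborel. G y * (LINT x|lborel. F x * cis (\<theta> x y)))"
proof -
  have [measurable]: "F \<in> borel_measurable borel" "G \<in> borel_measurable borel" using F G by auto
  have [measurable]: "cis \<in> borel_measurable borel"
    by (intro borel_measurable_continuous_onI continuous_intros)
  let ?h = "\<lambda>(x, y). F x * (G y * cis (\<theta> x y))"
  have m: "?h \<in> borel_measurable (borel \<Otimes>\<^sub>M borel)"
    by measurable
  have iG: "integrable lborel (\<lambda>y. G y * cis (\<theta> x y))" for x
  proof (rule Bochner_Integration.integrable_bound[OF G])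
    show "(\<lambda>y. G y * cis (\<theta> x y)) \<in> borel_measurable lborel"
      by measurable
  qed (auto simp: norm_mult)
  have ih: "integrable (lborel \<Otimes>\<^sub>M lborel) ?h"
  proof (rule lborel_pair.Fubini_integrable)
    show "?h \<in> borel_measurable (lborel \<Otimes>\<^sub>M lborel)" using m by (simp cong: measurable_cong_sets)
    show "integrable lborel (\<lambda>x. LINT y|lborel. norm (?h (x, y)))"
      using F by (simp add: norm_mult integrable_norm)
    show "AE x in lborel. integrable lborel (\<lambda>y. ?h (x, y))"
      using iG by auto
  qed
  have "(LINT x|lborel. F x * (LINT y|lborel. G y * cis (\<theta> x y))) = (LINT x|lborel. (LINT y|lborel. ?h (x, y)))"
    by simp
  also have "\<dots> = (LINT y|lborel. (LINT x|lborel. ?h (x, y)))"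
    using lborel_pair.Fubini_integral[of "\<lambda>x y. ?h (x, y)"] ih by simp
  also have "\<dots> = (LINT y|lborel. (LINT x|lborel. G y * (F x * cis (\<theta> x y))))"
    by (simp add: mult_ac)
  finally show ?thesis by simp
qed

section \<open>Plancherel and inversion for continuous integrable functions\<close>

definition gauss_smoothing :: "real \<Rightarrow> (real ^ 'n \<Rightarrow> complex) \<Rightarrow> real ^ 'n \<Rightarrow> complex" where
  "gauss_smoothing s g \<xi> = (LINT \<eta>|lborel. g \<eta> * of_real (gauss_kernel s (\<eta> - \<xi>)))"

lemma gauss_smoothing_measurable [measurable]:
  assumes [measurable]: "g \<in> borel_measurable borel"
  shows "gauss_smoothing s g \<in> borel_measurable borel"
  unfolding gauss_smoothing_def[abs_def] by measurable

text \<open>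
  Rescaling \<open>\<eta> = \<xi> + sqrt s z\<close> turns the smoothing into an average of \<open>g (\<xi> + sqrt s z)\<close> against a fixed
  density, so that dominated convergence applies.
\<close>
lemma gauss_smoothing_tendsto:
  fixes g :: "real ^ 'n \<Rightarrow> complex"
  assumes cont: "continuous_on UNIV g" and B: "\<And>x. cmod (g x) \<le> B"
    and s: "\<And>m. s m > 0" "s \<longlonglongrightarrow> 0"
  shows "(\<lambda>m. gauss_smoothing (s m) g \<xi>) \<longlonglongrightarrow> g \<xi>"
proof -
  have [measurable]: "g \<in> borel_measurable borel"
    using cont by (rule borel_measurable_continuous_onI)
  let ?k = "gauss_kernel 1 :: real ^ 'n \<Rightarrow> real"
  have k: "integrable lborel ?k" "(LINT z|lborel. ?k z) = 1"
    using integrable_gauss_kernel[of 1] integral_gauss_kernel[of 1] by auto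
  have eq: "gauss_smoothing (s m) g \<xi> = (LINT z|lborel. g (\<xi> + sqrt (s m) *\<^sub>R z) * of_real (?k z))" for m
  proof -
    have [simp]: "s m > 0" "sqrt (s m) > 0" using s by auto
    have *: "sqrt (s m) ^ DIM(real ^ 'n) *\<^sub>R (g y * of_real (gauss_kernel (s m) (sqrt (s m) *\<^sub>R z)))
        = g y * of_real (?k z)" for y z
    proof -
      have "(norm (sqrt (s m) *\<^sub>R z))\<^sup>2 / s m = (norm z)\<^sup>2"
        using less_imp_neq[OF \<open>s m > 0\<close>] by (simp add: power_mult_distrib less_imp_le)
      then have "gauss_kernel (s m) (sqrt (s m) *\<^sub>R z) = ?k z / sqrt (s m) ^ DIM(real ^ 'n)"
        unfolding gauss_kernel_def by (simp add: times_divide_eq_right[symmetric] del: times_divide_eq_right)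
      then show ?thesis
        using less_imp_neq[OF \<open>s m > 0\<close>] by (simp add: scaleR_conv_of_real)
    qed
    have "gauss_smoothing (s m) g \<xi> = sqrt (s m) ^ DIM(real ^ 'n) *\<^sub>R
      (LINT z|lborel. g (\<xi> + sqrt (s m) *\<^sub>R z) * of_real (gauss_kernel (s m) ((\<xi> + sqrt (s m) *\<^sub>R z) - \<xi>)))"
      unfolding gauss_smoothing_def by (rule lborel_integral_affine) auto
    also have "\<dots> = (LINT z|lborel. sqrt (s m) ^ DIM(real ^ 'n) *\<^sub>R
      (g (\<xi> + sqrt (s m) *\<^sub>R z) * of_real (gauss_kernel (s m) (sqrt (s m) *\<^sub>R z))))"
      by (subst integral_scaleR_right) auto
    finally show ?thesis unfolding * .
  qed
  have "(\<lambda>m. LINT z|lborel. g (\<xi> + sqrt (s m) *\<^sub>R z) * of_real (?k z))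
      \<longlonglongrightarrow> (LINT z|lborel. g \<xi> * of_real (?k z))"
  proof (rule integral_dominated_convergence[where w="\<lambda>z. B * ?k z"])
    show "AE z in lborel. (\<lambda>m. g (\<xi> + sqrt (s m) *\<^sub>R z) * of_real (?k z)) \<longlonglongrightarrow> g \<xi> * of_real (?k z)"
    proof (intro AE_I2 tendsto_mult tendsto_const)
      fix z
      have "(\<lambda>m. \<xi> + sqrt (s m) *\<^sub>R z) \<longlonglongrightarrow> \<xi> + sqrt 0 *\<^sub>R z"
        by (intro tendsto_intros s)
      moreover have "isCont g \<xi>" using cont by (simp add: continuous_on_eq_continuous_at)
      ultimately show "(\<lambda>m. g (\<xi> + sqrt (s m) *\<^sub>R z)) \<longlonglongrightarrow> g \<xi>"
        using isCont_tendsto_compose by fastforce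
    qed
  qed (use k B in \<open>auto simp: norm_mult intro!: mult_right_mono\<close>)
  then show ?thesis unfolding eq using k by simp
qed

text \<open>
  Jensen's inequality for the probability density \<open>gauss_kernel s (\<eta> - \<xi>)\<close>, in the form that the
  variance of \<open>cmod (g \<eta>)\<close> under it is nonnegative.
\<close>
lemma gauss_smoothing_norm_sq_le:
  fixes g :: "real ^ 'n \<Rightarrow> complex"
  assumes [measurable]: "g \<in> borel_measurable borel" and B: "\<And>x. cmod (g x) \<le> B" and s: "s > 0"
  shows "(cmod (gauss_smoothing s g \<xi>))\<^sup>2 \<le> (LINT \<eta>|lborel. (cmod (g \<eta>))\<^sup>2 * gauss_kernel s (\<eta> - \<xi>))"
proof -
  let ?k = "\<lambda>\<eta>. gauss_kernel s (\<eta> - \<xi>)"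
  have k: "integrable lborel ?k" "(LINT \<eta>|lborel. ?k \<eta>) = 1"
    using integrable_gauss_kernel_shift[OF s] integral_gauss_kernel_shift[OF s] by auto
  have B0: "B \<ge> 0" using B[of undefined] norm_ge_zero order_trans by blast
  have i1: "integrable lborel (\<lambda>\<eta>. cmod (g \<eta>) * ?k \<eta>)"
    by (rule Bochner_Integration.integrable_bound[where f="\<lambda>\<eta>. B * ?k \<eta>"])
       (use k B B0 s in \<open>auto simp: abs_mult intro!: mult_right_mono\<close>)
  have i2: "integrable lborel (\<lambda>\<eta>. (cmod (g \<eta>))\<^sup>2 * ?k \<eta>)"
    by (rule Bochner_Integration.integrable_bound[where f="\<lambda>\<eta>. B\<^sup>2 * ?k \<eta>"])
       (use k B B0 s in \<open>auto simp: abs_mult intro!: mult_right_mono power_mono\<close>)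
  \<comment> \<open>the mean of \<open>cmod (g \<eta>)\<close> under the density\<close>
  define a where "a = (LINT \<eta>|lborel. cmod (g \<eta>) * ?k \<eta>)"
  have "cmod (gauss_smoothing s g \<xi>) \<le> (LINT \<eta>|lborel. cmod (g \<eta> * of_real (?k \<eta>)))"
    unfolding gauss_smoothing_def by (rule integral_norm_bound)
  also have "\<dots> = a" using s by (simp add: a_def norm_mult)
  finally have 1: "cmod (gauss_smoothing s g \<xi>) \<le> a" .
  have "0 \<le> (LINT \<eta>|lborel. (cmod (g \<eta>) - a)\<^sup>2 * ?k \<eta>)"
    using s by (intro integral_nonneg_AE) auto
  also have "\<dots> = (LINT \<eta>|lborel. (cmod (g \<eta>))\<^sup>2 * ?k \<eta> - 2 * a * (cmod (g \<eta>) * ?k \<eta>) + a\<^sup>2 * ?k \<eta>)"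
    by (simp add: power2_diff algebra_simps)
  also have "\<dots> = (LINT \<eta>|lborel. (cmod (g \<eta>))\<^sup>2 * ?k \<eta>) - 2 * a * a + a\<^sup>2"
    using i1 i2 k by (simp add: a_def)
  finally have "a\<^sup>2 \<le> (LINT \<eta>|lborel. (cmod (g \<eta>))\<^sup>2 * ?k \<eta>)"
    by (simp add: power2_eq_square)
  moreover have "(cmod (gauss_smoothing s g \<xi>))\<^sup>2 \<le> a\<^sup>2"
    using 1 by (intro power_mono) auto
  ultimately show ?thesis by linarith
qed

lemma norm2_sq_gauss_smoothing_le:
  fixes g :: "real ^ 'n \<Rightarrow> complex"
  assumes [measurable]: "g \<in> borel_measurable borel" and B: "\<And>x. cmod (g x) \<le> B" and s: "s > 0"
  shows "norm2_sq (gauss_smoothing s g) \<le> norm2_sq g"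
proof -
  have k: "(\<integral>\<^sup>+\<xi>. ennreal (gauss_kernel s (\<eta> - \<xi>)) \<partial>lborel) = 1" for \<eta> :: "real ^ 'n"
  proof -
    have "(\<integral>\<^sup>+\<xi>. ennreal (gauss_kernel s (\<eta> - \<xi>)) \<partial>lborel) = (\<integral>\<^sup>+\<xi>. ennreal (gauss_kernel s (\<xi> - \<eta>)) \<partial>lborel)"
      by (subst gauss_kernel_minus[symmetric]) simp
    also have "\<dots> = ennreal (LINT \<xi>|lborel. gauss_kernel s (\<xi> - \<eta>))"
      using s by (intro nn_integral_eq_integral integrable_gauss_kernel_shift) auto
    finally show ?thesis using s by (simp add: integral_gauss_kernel_shift)
  qed
  have "norm2_sq (gauss_smoothing s g) \<le>
      (\<integral>\<^sup>+\<xi>. \<integral>\<^sup>+\<eta>. ennreal ((cmod (g \<eta>))\<^sup>2 * gauss_kernel s (\<eta> - \<xi>)) \<partial>lborel \<partial>lborel)"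
    unfolding norm2_sq_def
  proof (intro nn_integral_mono)
    fix \<xi>
    have "ennreal ((cmod (gauss_smoothing s g \<xi>))\<^sup>2) \<le>
        ennreal (LINT \<eta>|lborel. (cmod (g \<eta>))\<^sup>2 * gauss_kernel s (\<eta> - \<xi>))"
      by (intro ennreal_leI gauss_smoothing_norm_sq_le[OF assms(1) B s])
    also have "\<dots> \<le> (\<integral>\<^sup>+\<eta>. ennreal ((cmod (g \<eta>))\<^sup>2 * gauss_kernel s (\<eta> - \<xi>)) \<partial>lborel)"
      by (cases "integrable lborel (\<lambda>\<eta>. (cmod (g \<eta>))\<^sup>2 * gauss_kernel s (\<eta> - \<xi>))")
         (use s in \<open>auto simp: nn_integral_eq_integral not_integrable_integral_eq\<close>)
    finally show "ennreal ((cmod (gauss_smoothing s g \<xi>))\<^sup>2) \<le>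
      (\<integral>\<^sup>+\<eta>. ennreal ((cmod (g \<eta>))\<^sup>2 * gauss_kernel s (\<eta> - \<xi>)) \<partial>lborel)" .
  qed
  also have "\<dots> = (\<integral>\<^sup>+\<eta>. \<integral>\<^sup>+\<xi>. ennreal ((cmod (g \<eta>))\<^sup>2) * ennreal (gauss_kernel s (\<eta> - \<xi>)) \<partial>lborel \<partial>lborel)"
    using s by (subst lborel_pair.Fubini') (auto simp: ennreal_mult)
  also have "\<dots> = norm2_sq g"
    by (simp add: nn_integral_cmult k norm2_sq_def)
  finally show ?thesis .
qed

abbreviation inverse_fourier :: "(real ^ 'n \<Rightarrow> complex) \<Rightarrow> real ^ 'n \<Rightarrow> complex" where
  "inverse_fourier g x \<equiv> solution g x 0"

lemma inverse_fourier_eq: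
  "inverse_fourier g x = (LINT \<xi>|lborel. g \<xi> * cis (2 * pi * (x \<bullet> \<xi>)))"
  by (simp add: solution_def)

lemma cnj_measurable [measurable]: "cnj \<in> borel_measurable borel"
  by (intro borel_measurable_continuous_onI continuous_intros)

lemma cis_measurable [measurable]: "cis \<in> borel_measurable borel"
  by (intro borel_measurable_continuous_onI continuous_intros)

lemma inverse_fourier_measurable [measurable]:
  assumes [measurable]: "g \<in> borel_measurable borel"
  shows "inverse_fourier g \<in> borel_measurable borel"
  unfolding inverse_fourier_eq[abs_def] by measurable

lemma cmod_inverse_fourier_le:
  "cmod (inverse_fourier g x) \<le> (LINT \<xi>|lborel. cmod (g \<xi>))"
  unfolding inverse_fourier_eq by (rule order_trans[OF integral_norm_bound]) (simp add: norm_mult)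

text \<open>
  The inverse transform of an integrable \<open>g\<close> need not be integrable. Multiplied by a Gaussian
  it is, and its Fourier transform is then \<open>g\<close> smoothed by the Gaussian kernel; these are the
  approximants required by \<^const>\<open>has_fourier_transform\<close>.
\<close>
definition gauss_damped :: "real \<Rightarrow> (real ^ 'n \<Rightarrow> complex) \<Rightarrow> real ^ 'n \<Rightarrow> complex" where
  "gauss_damped s g x = inverse_fourier g x * of_real (exp (-(pi * s * (norm x)\<^sup>2)))"

lemma gauss_damped_measurable [measurable]:
  assumes [measurable]: "g \<in> borel_measurable borel"
  shows "gauss_damped s g \<in> borel_measurable borel"
  unfolding gauss_damped_def[abs_def] by measurable

lemma gaussian_integrable:
  assumes s: "s > 0"
  shows "integrable lborel (\<lambda>x::'a::euclidean_space. exp (-(pi * s * (norm x)\<^sup>2)))"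
proof -
  have "integrable lborel (\<lambda>x::'a. complex_of_real (exp (-(pi * s * (norm x)\<^sup>2))))"
    using integrable_gaussian_cis[OF s, of "0::'a"] by simp
  then show ?thesis by (subst (asm) complex_of_real_integrable_eq)
qed

lemma gauss_damped_integrable:
  fixes g :: "real ^ 'n \<Rightarrow> complex"
  assumes [measurable]: "g \<in> borel_measurable borel" and s: "s > 0"
  shows "integrable lborel (gauss_damped s g)"
proof (rule Bochner_Integration.integrable_bound)
  show "integrable lborel (\<lambda>x::real ^ 'n. (LINT \<xi>|lborel. cmod (g \<xi>)) * exp (-(pi * s * (norm x)\<^sup>2)))"
    by (intro integrable_mult_right gaussian_integrable s)
  show "AE x in lborel. cmod (gauss_damped s g x) \<le>
      norm ((LINT \<xi>|lborel. cmod (g \<xi>)) * exp (-(pi * s * (norm x)\<^sup>2)))"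
    using cmod_inverse_fourier_le[of g] by (auto simp: gauss_damped_def norm_mult abs_mult intro!: mult_right_mono)
qed auto

lemma fourier_gauss_damped:
  fixes g :: "real ^ 'n \<Rightarrow> complex"
  assumes g: "integrable lborel g" and s: "s > 0"
  shows "fourier_L1 (gauss_damped s g) \<xi> = gauss_smoothing s g \<xi>"
proof -
  let ?F = "\<lambda>x. of_real (exp (-(pi * s * (norm x)\<^sup>2))) * cis (2 * pi * (x \<bullet> (- \<xi>)))"
  have "fourier_L1 (gauss_damped s g) \<xi> =
      (LINT x|lborel. ?F x * (LINT y|lborel. g y * cis (2 * pi * (x \<bullet> y))))"
    unfolding fourier_L1_def gauss_damped_def inverse_fourier_eq by (simp add: mult_ac)
  also have "\<dots> = (LINT y|lborel. g y * (LINT x|lborel. ?F x * cis (2 * pi * (x \<bullet> y))))"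
    by (intro multiplication_formula integrable_gaussian_cis g s) measurable
  also have "(\<lambda>y. LINT x|lborel. ?F x * cis (2 * pi * (x \<bullet> y))) = (\<lambda>y. of_real (gauss_kernel s (y - \<xi>)))"
  proof
    fix y
    have "(LINT x|lborel. ?F x * cis (2 * pi * (x \<bullet> y))) =
      (LINT x|lborel. of_real (exp (-(pi * s * (norm x)\<^sup>2))) * cis (2 * pi * (x \<bullet> (y - \<xi>))))"
      by (simp add: mult.assoc cis_mult inner_diff_right right_diff_distrib)
    then show "(LINT x|lborel. ?F x * cis (2 * pi * (x \<bullet> y))) = of_real (gauss_kernel s (y - \<xi>))"
      using integral_gaussian_cis[OF s, of "y - \<xi>"] by (simp add: gauss_kernel_def)
  qed
  finally show ?thesis by (simp add: gauss_smoothing_def)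
qed

lemma damped_energy:
  fixes g :: "real ^ 'n \<Rightarrow> complex"
  assumes g: "integrable lborel g" and s: "s > 0"
  shows "complex_of_real (LINT x|lborel. (cmod (inverse_fourier g x))\<^sup>2 * exp (-(pi * s * (norm x)\<^sup>2)))
       = (LINT \<xi>|lborel. cnj (g \<xi>) * gauss_smoothing s g \<xi>)"
proof -
  have [measurable]: "g \<in> borel_measurable borel" using g by auto
  have c: "cnj (inverse_fourier g x) = (LINT y|lborel. cnj (g y) * cis (- (2 * pi * (x \<bullet> y))))" for x
    using Bochner_Integration.integral_cnj[of lborel "\<lambda>y. g y * cis (2 * pi * (x \<bullet> y))", symmetric]
    unfolding inverse_fourier_eq by (simp add: cis_cnj del: Bochner_Integration.integral_cnj)
  have "complex_of_real (LINT x|lborel. (cmod (inverse_fourier g x))\<^sup>2 * exp (-(pi * s * (norm x)\<^sup>2)))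
      = (LINT x|lborel. gauss_damped s g x * cnj (inverse_fourier g x))"
    by (subst integral_complex_of_real[symmetric])
       (simp add: gauss_damped_def complex_norm_square mult_ac del: of_real_power)
  also have "\<dots> = (LINT y|lborel. cnj (g y) * (LINT x|lborel. gauss_damped s g x * cis (- (2 * pi * (x \<bullet> y)))))"
    unfolding c by (intro multiplication_formula gauss_damped_integrable s) (use g in auto)
  also have "\<dots> = (LINT \<xi>|lborel. cnj (g \<xi>) * gauss_smoothing s g \<xi>)"
    using fourier_gauss_damped[OF g s] by (simp add: fourier_L1_def)
  finally show ?thesis .
qed

context
  fixes g :: "real ^ 'n \<Rightarrow> complex" and B :: real
  assumes g: "integrable lborel g" and cont: "continuous_on UNIV g" and B: "\<And>x. cmod (g x) \<le> B"
begin

private lemma g_meas: "g \<in> borel_measurable borel"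
  using g by auto

private lemma g_sq_integrable: "integrable lborel (\<lambda>x. (cmod (g x))\<^sup>2)"
  supply [measurable] = g_meas
proof (rule Bochner_Integration.integrable_bound)
  show "integrable lborel (\<lambda>x. B * cmod (g x))" using g by simp
  show "AE x in lborel. norm ((cmod (g x))\<^sup>2) \<le> norm (B * cmod (g x))"
    using B order_trans[OF norm_ge_zero B] by (auto simp: power2_eq_square abs_mult intro!: mult_right_mono)
qed auto

private lemma norm2_sq_g: "norm2_sq g = ennreal (LINT x|lborel. (cmod (g x))\<^sup>2)"
  unfolding norm2_sq_def using g_sq_integrable by (intro nn_integral_eq_integral) auto

private abbreviation "\<sigma> m \<equiv> 1 / real (Suc m)"

private lemma sigma: "\<sigma> m > 0" "\<sigma> \<longlonglongrightarrow> 0"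
  using LIMSEQ_inverse_real_of_nat by (auto simp: inverse_eq_divide)

private lemma cmod_smoothing_le: "s > 0 \<Longrightarrow> cmod (gauss_smoothing s g \<xi>) \<le> B"
proof -
  note [measurable] = g_meas
  assume s: "s > 0"
  have "cmod (gauss_smoothing s g \<xi>) \<le> (LINT \<eta>|lborel. cmod (g \<eta> * of_real (gauss_kernel s (\<eta> - \<xi>))))"
    unfolding gauss_smoothing_def by (rule integral_norm_bound)
  also have "\<dots> \<le> (LINT \<eta>|lborel. B * gauss_kernel s (\<eta> - \<xi>))"
    using B s order_trans[OF norm_ge_zero B] integrable_gauss_kernel_shift[OF s, of \<xi>]
    by (intro integral_mono_AE' ) (auto simp: norm_mult intro!: mult_right_mono)
  also have "\<dots> = B" using s by (simp add: integral_gauss_kernel_shift)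
  finally show ?thesis .
qed

private lemma inner_smoothing_tendsto:
  "(\<lambda>m. LINT \<xi>|lborel. cnj (g \<xi>) * gauss_smoothing (\<sigma> m) g \<xi>) \<longlonglongrightarrow> of_real (LINT x|lborel. (cmod (g x))\<^sup>2)"
proof -
  note [measurable] = g_meas
  have "(\<lambda>m. LINT \<xi>|lborel. cnj (g \<xi>) * gauss_smoothing (\<sigma> m) g \<xi>) \<longlonglongrightarrow> (LINT \<xi>|lborel. cnj (g \<xi>) * g \<xi>)"
  proof (rule integral_dominated_convergence[where w="\<lambda>\<xi>. B * cmod (g \<xi>)"])
    show "AE \<xi> in lborel. (\<lambda>m. cnj (g \<xi>) * gauss_smoothing (\<sigma> m) g \<xi>) \<longlonglongrightarrow> cnj (g \<xi>) * g \<xi>"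
      using gauss_smoothing_tendsto[OF cont B sigma] by (intro AE_I2 tendsto_intros) auto
    show "AE \<xi> in lborel. norm (cnj (g \<xi>) * gauss_smoothing (\<sigma> m) g \<xi>) \<le> B * cmod (g \<xi>)" for m
      using cmod_smoothing_le[OF sigma(1)] by (auto simp: norm_mult mult.commute[of B] intro!: mult_left_mono)
  qed (use g in simp_all)
  also have "(LINT \<xi>|lborel. cnj (g \<xi>) * g \<xi>) = of_real (LINT x|lborel. (cmod (g x))\<^sup>2)"
    by (subst integral_complex_of_real[symmetric]) (simp add: complex_norm_square mult.commute del: of_real_power)
  finally show ?thesis .
qed

text \<open>
  The energy of the inverse transform, weighted by a Gaussian, increases to the full energy as the
  Gaussian tends to 1, while \<open>damped_energy\<close> writes it as a pairing of \<open>g\<close> with its own smoothing, which tends to the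
  energy of \<open>g\<close>.
\<close>
lemma plancherel: "norm2_sq (inverse_fourier g) = norm2_sq g"
proof -
  note [measurable] = g_meas
  let ?u = "inverse_fourier g"
  let ?E = "\<lambda>m x. (cmod (?u x))\<^sup>2 * exp (-(pi * \<sigma> m * (norm x)\<^sup>2))"
  have int: "integrable lborel (?E m)" for m
  proof (rule Bochner_Integration.integrable_bound)
    show "integrable lborel (\<lambda>x::real ^ 'n. (LINT \<xi>|lborel. cmod (g \<xi>))\<^sup>2 * exp (-(pi * \<sigma> m * (norm x)\<^sup>2)))"
      by (intro integrable_mult_right gaussian_integrable sigma)
    show "AE x in lborel. norm (?E m x) \<le> norm ((LINT \<xi>|lborel. cmod (g \<xi>))\<^sup>2 * exp (-(pi * \<sigma> m * (norm x)\<^sup>2)))"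
      using cmod_inverse_fourier_le[of g] by (auto simp: abs_mult intro!: mult_right_mono power_mono)
  qed auto
  have E: "(\<integral>\<^sup>+x. ennreal (?E m x) \<partial>lborel) = ennreal (LINT x|lborel. ?E m x)" for m
    by (rule nn_integral_eq_integral[OF int]) auto
  have "(\<lambda>m. complex_of_real (LINT x|lborel. ?E m x)) \<longlonglongrightarrow> of_real (LINT x|lborel. (cmod (g x))\<^sup>2)"
    using inner_smoothing_tendsto unfolding damped_energy[OF g sigma(1), symmetric] .
  then have "(\<lambda>m. ennreal (LINT x|lborel. ?E m x)) \<longlonglongrightarrow> ennreal (LINT x|lborel. (cmod (g x))\<^sup>2)"
    unfolding tendsto_of_real_iff by (rule tendsto_ennrealI)
  then have 1: "(\<lambda>m. \<integral>\<^sup>+x. ennreal (?E m x) \<partial>lborel) \<longlonglongrightarrow> norm2_sq g"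
    unfolding E norm2_sq_g .
  have mono: "?E m x \<le> ?E (Suc m) x" for m x
    by (intro mult_left_mono) (auto intro!: mult_right_mono divide_left_mono)
  have "(\<lambda>m. \<integral>\<^sup>+x. ennreal (?E m x) \<partial>lborel) \<longlonglongrightarrow> (\<integral>\<^sup>+x. ennreal ((cmod (?u x))\<^sup>2) \<partial>lborel)"
  proof (rule nn_integral_LIMSEQ)
    show "incseq (\<lambda>m x. ennreal (?E m x))"
      using mono by (intro incseq_SucI le_funI ennreal_leI)
    fix x
    have "(\<lambda>m. ?E m x) \<longlonglongrightarrow> (cmod (?u x))\<^sup>2 * exp (-(pi * 0 * (norm x)\<^sup>2))"
      by (intro tendsto_intros sigma)
    then show "(\<lambda>m. ennreal (?E m x)) \<longlonglongrightarrow> ennreal ((cmod (?u x))\<^sup>2)"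
      by (intro tendsto_ennrealI) simp
  qed auto
  from LIMSEQ_unique[OF this 1] show ?thesis by (simp add: norm2_sq_def)
qed

lemma damped_L2_tendsto:
  "(\<lambda>m. norm2_sq (\<lambda>x. gauss_damped (\<sigma> m) g x - inverse_fourier g x)) \<longlonglongrightarrow> 0"
proof -
  note [measurable] = g_meas
  let ?u = "inverse_fourier g"
  have "(\<lambda>m. \<integral>\<^sup>+x. ennreal ((cmod (gauss_damped (\<sigma> m) g x - ?u x))\<^sup>2) \<partial>lborel) \<longlonglongrightarrow> (\<integral>\<^sup>+(x::real ^ 'n). 0 \<partial>lborel)"
  proof (rule nn_integral_dominated_convergence[where w="\<lambda>x. ennreal ((cmod (?u x))\<^sup>2)"])
    have eq: "gauss_damped (\<sigma> m) g x - ?u x = ?u x * of_real (exp (-(pi * \<sigma> m * (norm x)\<^sup>2)) - 1)" for m x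
      by (simp add: gauss_damped_def algebra_simps)
    show "AE x in lborel. ennreal ((cmod (gauss_damped (\<sigma> m) g x - ?u x))\<^sup>2) \<le> ennreal ((cmod (?u x))\<^sup>2)" for m
    proof (intro AE_I2 ennreal_leI power_mono)
      fix x :: "real ^ 'n"
      have "exp (-(pi * \<sigma> m * (norm x)\<^sup>2)) \<le> 1" "exp (-(pi * \<sigma> m * (norm x)\<^sup>2)) > 0"
        by (subst exp_le_one_iff) (auto simp del: of_nat_Suc)
      then have "\<bar>exp (-(pi * \<sigma> m * (norm x)\<^sup>2)) - 1\<bar> \<le> 1" by linarith
      then show "cmod (gauss_damped (\<sigma> m) g x - ?u x) \<le> cmod (?u x)"
        unfolding eq norm_mult norm_of_real by (intro mult_left_le) auto
    qed auto
    show "AE x in lborel. (\<lambda>m. ennreal ((cmod (gauss_damped (\<sigma> m) g x - ?u x))\<^sup>2)) \<longlonglongrightarrow> 0"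
    proof (intro AE_I2)
      fix x :: "real ^ 'n"
      have "(\<lambda>m. (cmod (?u x * of_real (exp (-(pi * \<sigma> m * (norm x)\<^sup>2)) - 1)))\<^sup>2)
          \<longlonglongrightarrow> (cmod (?u x * of_real (exp (-(pi * 0 * (norm x)\<^sup>2)) - 1)))\<^sup>2"
        by (intro tendsto_intros sigma)
      from tendsto_ennrealI[OF this]
      show "(\<lambda>m. ennreal ((cmod (gauss_damped (\<sigma> m) g x - ?u x))\<^sup>2)) \<longlonglongrightarrow> 0"
        unfolding eq by simp
    qed
    show "(\<integral>\<^sup>+x. ennreal ((cmod (?u x))\<^sup>2) \<partial>lborel) < \<infinity>"
      using plancherel norm2_sq_g by (simp add: norm2_sq_def)
  qed auto
  then show ?thesis by (simp add: norm2_sq_def)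
qed

text \<open>
  Expand the square of \<open>gauss_smoothing s g - g\<close>: smoothing does not increase the norm, and the cross
  term tends to twice the energy of \<open>g\<close> by the pointwise convergence above.
\<close>
lemma smoothing_L2_tendsto:
  "(\<lambda>m. norm2_sq (\<lambda>\<xi>. gauss_smoothing (\<sigma> m) g \<xi> - g \<xi>)) \<longlonglongrightarrow> 0"
proof -
  note [measurable] = g_meas
  let ?c = "\<lambda>m. gauss_smoothing (\<sigma> m) g"
  let ?G = "LINT x|lborel. (cmod (g x))\<^sup>2"
  have c_le: "norm2_sq (?c m) \<le> ennreal ?G" for m
    using norm2_sq_gauss_smoothing_le[OF g_meas B sigma(1)] norm2_sq_g by simp
  have ci: "integrable lborel (\<lambda>x. (cmod (?c m x))\<^sup>2)" for m
    using c_le[of m] unfolding norm2_sq_def by (intro integrableI_bounded) (auto simp: less_top[symmetric] top_unique)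
  have cG: "(LINT x|lborel. (cmod (?c m x))\<^sup>2) \<le> ?G" for m
    using c_le[of m] nn_integral_eq_integral[OF ci[of m]]
    by (simp add: norm2_sq_def ennreal_le_iff integral_nonneg_AE)
  have ii: "integrable lborel (\<lambda>\<xi>. cnj (g \<xi>) * ?c m \<xi>)" for m
  proof (rule Bochner_Integration.integrable_bound[where f="\<lambda>\<xi>. B * cmod (g \<xi>)"])
    show "AE \<xi> in lborel. norm (cnj (g \<xi>) * ?c m \<xi>) \<le> norm (B * cmod (g \<xi>))"
      using cmod_smoothing_le[OF sigma(1)] order_trans[OF norm_ge_zero B]
      by (auto simp: norm_mult abs_mult mult.commute[of B] intro!: mult_left_mono)
  qed (use g in auto)
  have eq: "(cmod (?c m x - g x))\<^sup>2 = (cmod (?c m x))\<^sup>2 + (cmod (g x))\<^sup>2 - 2 * Re (cnj (g x) * ?c m x)" for m x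
    by (simp add: cmod_power2 power2_diff algebra_simps)
  have di: "integrable lborel (\<lambda>x. (cmod (?c m x - g x))\<^sup>2)" for m
    unfolding eq by (intro Bochner_Integration.integrable_add Bochner_Integration.integrable_diff
      integrable_mult_right ci integrable_Re ii g_sq_integrable)
  have bound: "(LINT x|lborel. (cmod (?c m x - g x))\<^sup>2) \<le> 2 * ?G - 2 * Re (LINT \<xi>|lborel. cnj (g \<xi>) * ?c m \<xi>)" for m
  proof -
  note [measurable] = g_meas
    have "(LINT x|lborel. (cmod (?c m x - g x))\<^sup>2)
        = (LINT x|lborel. (cmod (?c m x))\<^sup>2) + ?G - 2 * Re (LINT \<xi>|lborel. cnj (g \<xi>) * ?c m \<xi>)"
    proof -
  note [measurable] = g_meas
      define R where "R = (\<lambda>x. Re (cnj (g x) * ?c m x))"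
      have R: "integrable lborel R" "(LINT x|lborel. R x) = Re (LINT \<xi>|lborel. cnj (g \<xi>) * ?c m \<xi>)"
        unfolding R_def using ii[of m] by (auto simp only: integrable_Re integral_Re)
      have "(LINT x|lborel. (cmod (?c m x - g x))\<^sup>2)
          = (LINT x|lborel. (cmod (?c m x))\<^sup>2 + (cmod (g x))\<^sup>2 - 2 * R x)"
        by (simp only: eq R_def)
      then show ?thesis using ci[of m] g_sq_integrable R by simp
    qed
    then show ?thesis using cG[of m] by linarith
  qed
  have "(\<lambda>m. 2 * ?G - 2 * Re (LINT \<xi>|lborel. cnj (g \<xi>) * ?c m \<xi>)) \<longlonglongrightarrow> 2 * ?G - 2 * Re (of_real ?G)"
    by (intro tendsto_intros inner_smoothing_tendsto)
  then have lim: "(\<lambda>m. 2 * ?G - 2 * Re (LINT \<xi>|lborel. cnj (g \<xi>) * ?c m \<xi>)) \<longlonglongrightarrow> 0" by simp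
  have "(\<lambda>m. LINT x|lborel. (cmod (?c m x - g x))\<^sup>2) \<longlonglongrightarrow> 0"
    by (rule tendsto_sandwich[OF always_eventually always_eventually tendsto_const lim])
       (auto simp only: bound intro!: integral_nonneg_AE AE_I2 zero_le_power2)
  from tendsto_ennrealI[OF this] show ?thesis
    by (simp add: norm2_sq_def nn_integral_eq_integral[OF di] del: of_nat_Suc)
qed

lemma has_fourier_transform_inverse_fourier: "has_fourier_transform (inverse_fourier g) g"
proof -
  note [measurable] = g_meas
  have u: "inverse_fourier g \<in> L2"
    using plancherel norm2_sq_g by (simp add: L2_def)
  have F: "gauss_damped (\<sigma> m) g \<in> L2" for m
  proof -
  note [measurable] = g_meas
    have "norm2_sq (gauss_damped (\<sigma> m) g) \<le> norm2_sq (inverse_fourier g)"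
      unfolding norm2_sq_def
      by (intro nn_integral_mono ennreal_leI power_mono)
         (auto simp: gauss_damped_def norm_mult intro!: mult_left_le)
    then show ?thesis using u by (auto simp: L2_def)
  qed
  have "g \<in> L2" using norm2_sq_g by (simp add: L2_def)
  then show ?thesis
    unfolding has_fourier_transform_def
    using u F gauss_damped_integrable[OF g_meas sigma(1)] damped_L2_tendsto smoothing_L2_tendsto
    by (auto simp: fourier_gauss_damped[OF g sigma(1)] simp del: of_nat_Suc intro!: exI[of _ "\<lambda>m. gauss_damped (\<sigma> m) g"])
qed

end

section \<open>Periodic functions and trigonometric polynomials\<close>

text \<open>
  The half-open cube is used in place of \<open>cbox 0 1\<close> because its lattice translates tile the space
  exactly: every point has a unique \<open>lattice_part\<close>.
\<close>
definition unit_cell :: "(real ^ 'n) set" where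
  "unit_cell = {y. \<forall>i. 0 \<le> y $ i \<and> y $ i < 1}"

definition lattice_part :: "real ^ 'n \<Rightarrow> real ^ 'n" where
  "lattice_part z = vec_of_int (\<chi> i. \<lfloor>z $ i\<rfloor>)"

lemma vec_of_int_diff: "vec_of_int (k - l) = vec_of_int k - vec_of_int l"
  and vec_of_int_0: "vec_of_int 0 = 0"
  by (auto simp: vec_of_int_def vec_eq_iff)

lemma diff_lattice_part_in_unit_cell:
  "a - lattice_part z \<in> unit_cell \<longleftrightarrow> lattice_part a = lattice_part z"
proof -
  have "(0 \<le> x - real_of_int \<lfloor>y\<rfloor> \<and> x - real_of_int \<lfloor>y\<rfloor> < 1) \<longleftrightarrow> \<lfloor>x\<rfloor> = \<lfloor>y\<rfloor>" for x y :: real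
    by linarith
  then show ?thesis
    by (simp add: unit_cell_def lattice_part_def vec_of_int_def vec_eq_iff)
qed

lemma add_lattice_part_in_unit_cell:
  "a + lattice_part z \<in> unit_cell \<longleftrightarrow> z + lattice_part a \<in> unit_cell"
proof -
  have "(0 \<le> x + real_of_int \<lfloor>y\<rfloor> \<and> x + real_of_int \<lfloor>y\<rfloor> < 1) \<longleftrightarrow> \<lfloor>x\<rfloor> = - \<lfloor>y\<rfloor>" for x y :: real
    by linarith
  note * = this
  have "a + lattice_part z \<in> unit_cell \<longleftrightarrow> (\<forall>i. \<lfloor>a $ i\<rfloor> = - \<lfloor>z $ i\<rfloor>)" for a z :: "real ^ 'n"
    by (simp add: unit_cell_def lattice_part_def vec_of_int_def *)
  then show ?thesis by (metis minus_equation_iff)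
qed

lemma unit_cell_measurable [measurable]: "unit_cell \<in> sets borel"
  unfolding unit_cell_def by measurable

lemma lattice_part_measurable [measurable]: "lattice_part \<in> borel_measurable borel"
proof (subst borel_measurable_euclidean_space, intro ballI)
  fix b :: "real ^ 'n" assume "b \<in> Basis"
  then obtain i where b: "b = axis i 1" by (auto simp: Basis_vec_def)
  show "(\<lambda>x. lattice_part x \<bullet> b) \<in> borel_measurable borel"
    unfolding b by (simp add: inner_axis lattice_part_def vec_of_int_def)
qed

lemma AE_cbox_unit_cell: "AE x in lborel. x \<in> cbox 0 (1::real ^ 'n) \<longleftrightarrow> x \<in> unit_cell"
proof -
  have "negligible (cbox 0 (1::real ^ 'n) - box 0 1)"
    by (rule negligible_frontier_interval)
  then have "cbox 0 (1::real ^ 'n) - box 0 1 \<in> null_sets lborel"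
    by (simp add: negligible_iff_null_sets null_sets_completion_iff)
  from AE_not_in[OF this] show ?thesis
  proof eventually_elim
    case (elim x)
    then show ?case
      by (force simp: mem_box_cart unit_cell_def less_imp_le)
  qed
qed

lemma nn_integral_cbox_eq_unit_cell:
  fixes f :: "real ^ 'n \<Rightarrow> ennreal"
  shows "(\<integral>\<^sup>+x\<in>cbox 0 1. f x \<partial>lborel) = (\<integral>\<^sup>+x\<in>unit_cell. f x \<partial>lborel)"
  using AE_cbox_unit_cell by (intro nn_integral_cong_AE) (auto split: split_indicator)

lemma emeasure_unit_cube: "emeasure lborel (cbox 0 (1::real ^ 'n)) = 1"
proof -
  have "1 \<bullet> b = 1" if "b \<in> Basis" for b :: "real ^ 'n"
    using that by (auto simp: Basis_vec_def inner_axis)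
  then show ?thesis by (simp add: emeasure_lborel_cbox_eq)
qed

lemma nn_integral_indicator_unit_cell:
  fixes a :: "real ^ 'n"
  shows
  "(\<integral>\<^sup>+z. indicator unit_cell (z + a) \<partial>lborel) = (1::ennreal)"
proof -
  have "(\<integral>\<^sup>+z. indicator unit_cell (z + a) \<partial>lborel) = (\<integral>\<^sup>+(z :: real ^ 'n). (indicator unit_cell z :: ennreal) \<partial>lborel)"
    using nn_integral_lborel_shift[of "indicator unit_cell" a] by (simp add: add.commute[of a])
  also have "\<dots> = (\<integral>\<^sup>+(z :: real ^ 'n)\<in>cbox 0 1. 1 \<partial>lborel)"
    by (subst nn_integral_cbox_eq_unit_cell) simp
  also have "\<dots> = 1" by (simp add: emeasure_unit_cube)
  finally show ?thesis .
qed

text \<open>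
  A sum over lattice translates, written as an integral over \<open>z\<close> because \<open>lattice_part\<close> is constant on
  the cells, which have volume one. In this form it follows from Fubini's theorem alone, and \<open>z\<close> can be
  rescaled like any other integration variable.
\<close>
lemma nn_integral_lattice_unfold:
  fixes F :: "real ^ 'n \<Rightarrow> ennreal"
  assumes [measurable]: "F \<in> borel_measurable borel"
  shows "(\<integral>\<^sup>+x. F x \<partial>lborel) = (\<integral>\<^sup>+z. (\<integral>\<^sup>+y\<in>unit_cell. F (lattice_part z + y) \<partial>lborel) \<partial>lborel)"
proof -
  have "(\<integral>\<^sup>+y\<in>unit_cell. F (lattice_part z + y) \<partial>lborel)
      = (\<integral>\<^sup>+x. F x * indicator unit_cell (x - lattice_part z) \<partial>lborel)" for z
    using nn_integral_lborel_shift[of "\<lambda>x. F x * indicator unit_cell (x - lattice_part z)" "lattice_part z"]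
    by simp
  then have "(\<integral>\<^sup>+z. (\<integral>\<^sup>+y\<in>unit_cell. F (lattice_part z + y) \<partial>lborel) \<partial>lborel)
      = (\<integral>\<^sup>+z. (\<integral>\<^sup>+x. F x * indicator unit_cell (x - lattice_part z) \<partial>lborel) \<partial>lborel)" by simp
  also have "\<dots> = (\<integral>\<^sup>+x. (\<integral>\<^sup>+z. F x * indicator unit_cell (x - lattice_part z) \<partial>lborel) \<partial>lborel)"
    by (rule lborel_pair.Fubini') measurable
  also have "\<dots> = (\<integral>\<^sup>+x. F x * (\<integral>\<^sup>+z. indicator unit_cell (z + - lattice_part x) \<partial>lborel) \<partial>lborel)"
    by (subst nn_integral_cmult[symmetric])
       (auto simp: indicator_def diff_lattice_part_in_unit_cell intro!: nn_integral_cong)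
  finally show ?thesis by (simp add: nn_integral_indicator_unit_cell del: add_uminus_conv_diff)
qed

text \<open>
  Unfold the integral over the shifted cell along the lattice; the pieces reassemble the cell itself,
  since exactly one lattice translate of any \<open>s - y\<close> lies in it.
\<close>
lemma nn_integral_periodic_shift:
  fixes f :: "real ^ 'n \<Rightarrow> ennreal"
  assumes [measurable]: "f \<in> borel_measurable borel"
    and per: "\<And>x k. f (x + vec_of_int k) = f x"
  shows "(\<integral>\<^sup>+x\<in>cbox 0 1. f (y + x) \<partial>lborel) = (\<integral>\<^sup>+x\<in>cbox 0 1. f x \<partial>lborel)"
proof -
  have per': "f (lattice_part z + s) = f s" for z s
    using per[of s] by (simp add: lattice_part_def add.commute)
  have "(\<integral>\<^sup>+x\<in>unit_cell. f (y + x) \<partial>lborel) = (\<integral>\<^sup>+x. f x * indicator unit_cell (x - y) \<partial>lborel)"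
    using nn_integral_lborel_shift[of "\<lambda>x. f x * indicator unit_cell (x - y)" y] by simp
  also have "\<dots> = (\<integral>\<^sup>+z. (\<integral>\<^sup>+s. f s * indicator unit_cell (lattice_part z + s - y) * indicator unit_cell s \<partial>lborel) \<partial>lborel)"
    by (subst nn_integral_lattice_unfold) (auto simp: per')
  also have "\<dots> = (\<integral>\<^sup>+s. (\<integral>\<^sup>+z. f s * indicator unit_cell (lattice_part z + s - y) * indicator unit_cell s \<partial>lborel) \<partial>lborel)"
    by (rule lborel_pair.Fubini') measurable
  also have "\<dots> = (\<integral>\<^sup>+s. (\<integral>\<^sup>+z. f s * indicator unit_cell s * indicator unit_cell (z + lattice_part (s - y)) \<partial>lborel) \<partial>lborel)"
  proof (intro nn_integral_cong)
    fix s z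
    have "lattice_part z + s - y \<in> unit_cell \<longleftrightarrow> z + lattice_part (s - y) \<in> unit_cell"
      using add_lattice_part_in_unit_cell[of "s - y" z] by (simp add: algebra_simps)
    then show "f s * indicator unit_cell (lattice_part z + s - y) * indicator unit_cell s
        = f s * indicator unit_cell s * indicator unit_cell (z + lattice_part (s - y))"
      by (simp add: indicator_def)
  qed
  also have "\<dots> = (\<integral>\<^sup>+s\<in>unit_cell. f s \<partial>lborel)"
    by (subst nn_integral_cmult) (auto simp: nn_integral_indicator_unit_cell)
  finally show ?thesis by (simp add: nn_integral_cbox_eq_unit_cell)
qed

lemma inner_vec_of_int_Ints: "vec_of_int k \<bullet> vec_of_int l \<in> \<int>"
  by (auto simp: inner_vec_def vec_of_int_def)

lemma cis_add_lattice:
  "cis (2 * pi * ((x + vec_of_int k) \<bullet> vec_of_int m)) = cis (2 * pi * (x \<bullet> vec_of_int m))"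
proof -
  obtain j where "vec_of_int k \<bullet> vec_of_int m = real_of_int j"
    using inner_vec_of_int_Ints Ints_cases by blast
  then have "2 * pi * ((x + vec_of_int k) \<bullet> vec_of_int m) = 2 * pi * (x \<bullet> vec_of_int m) + 2 * pi * real_of_int j"
    by (simp add: inner_add_left distrib_left)
  then show ?thesis by (simp add: cis_mult[symmetric] cis_multiple_2pi)
qed

lemma set_integrable_cbox:
  fixes h :: "real ^ 'n \<Rightarrow> 'b::{banach, second_countable_topology}"
  assumes "continuous_on UNIV h"
  shows "set_integrable lborel (cbox 0 1) h"
  unfolding set_integrable_def
  using assms by (intro borel_integrable_compact) (auto intro: continuous_on_subset)

lemma set_lebesgue_integral_sum:
  fixes f :: "'i \<Rightarrow> 'a \<Rightarrow> 'b::{banach, second_countable_topology}"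
  assumes "\<And>i. i \<in> I \<Longrightarrow> set_integrable M A (f i)"
  shows "(LINT x:A|M. (\<Sum>i\<in>I. f i x)) = (\<Sum>i\<in>I. (LINT x:A|M. f i x))"
  using assms unfolding set_lebesgue_integral_def set_integrable_def
  by (simp add: scaleR_sum_right)

text \<open>
  Translation by \<open>y\<close> preserves the integral and reverses its sign. Adding the constant 1 makes the
  integrand nonnegative, so that the translation invariance above, stated for \<^typ>\<open>ennreal\<close>, applies.
\<close>
lemma antiperiodic_integral_zero:
  fixes h :: "real ^ 'n \<Rightarrow> real"
  assumes cont: "continuous_on UNIV h" and B: "\<And>x. \<bar>h x\<bar> \<le> 1"
    and per: "\<And>x k. h (x + vec_of_int k) = h x" and anti: "\<And>x. h (y + x) = - h x"
  shows "(LINT x:cbox 0 1|lborel. h x) = 0"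
proof -
  have [measurable]: "h \<in> borel_measurable borel"
    using cont by (rule borel_measurable_continuous_onI)
  have int: "set_integrable lborel (cbox 0 1) h" by (rule set_integrable_cbox[OF cont])
  have one: "set_integrable lborel (cbox 0 (1::real ^ 'n)) (\<lambda>x. 1::real)"
    by (rule set_integrable_cbox) (rule continuous_on_const)
  have eq: "(\<integral>\<^sup>+x\<in>cbox 0 1. ennreal (1 + c * h x) \<partial>lborel) = ennreal (LINT x:cbox 0 1|lborel. (1 + c * h x))"
    and nn: "(LINT x:cbox 0 1|lborel. (1 + c * h x)) \<ge> 0"
    if "\<bar>c\<bar> = 1" for c
  proof -
    have pos: "1 + c * h x \<ge> 0" for x
    proof -
      have "\<bar>c * h x\<bar> \<le> 1" using that B by (simp add: abs_mult)
      then show ?thesis by linarith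
    qed
    have "set_integrable lborel (cbox 0 1) (\<lambda>x. 1 + c * h x)"
      using one int by (intro set_integral_add set_integrable_mult_right) auto
    then show "(\<integral>\<^sup>+x\<in>cbox 0 1. ennreal (1 + c * h x) \<partial>lborel) = ennreal (LINT x:cbox 0 1|lborel. (1 + c * h x))"
      using pos unfolding set_integrable_def set_lebesgue_integral_def
      by (subst nn_integral_eq_integral[symmetric]) (auto intro!: nn_integral_cong split: split_indicator)
    show "(LINT x:cbox 0 1|lborel. (1 + c * h x)) \<ge> 0"
      using pos unfolding set_lebesgue_integral_def by (intro integral_nonneg_AE) auto
  qed
  have "(\<integral>\<^sup>+x\<in>cbox 0 1. ennreal (1 + (-1) * h x) \<partial>lborel) = (\<integral>\<^sup>+x\<in>cbox 0 1. ennreal (1 + 1 * h x) \<partial>lborel)"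
    using nn_integral_periodic_shift[of "\<lambda>x. ennreal (1 + h x)" y] by (simp add: per anti)
  then have "ennreal (LINT x:cbox 0 1|lborel. (1 + (-1) * h x)) = ennreal (LINT x:cbox 0 1|lborel. (1 + 1 * h x))"
    using eq[of 1] eq[of "-1"] by simp
  then have "(LINT x:cbox 0 1|lborel. (1 + (-1) * h x)) = (LINT x:cbox 0 1|lborel. (1 + 1 * h x))"
    using nn[of 1] nn[of "-1"] by (subst (asm) ennreal_inj) auto
  then show ?thesis
    using one int by (simp add: set_integral_diff set_integral_add)
qed

lemma integral_character:
  fixes m :: "int ^ 'n"
  shows "(LINT x:cbox 0 1|lborel. cis (2 * pi * (x \<bullet> vec_of_int m))) = (if m = 0 then 1 else 0)"
proof (cases "m = 0")
  case True
  have "measure lborel (cbox 0 (1::real ^ 'n)) = 1"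
    by (simp only: measure_def emeasure_unit_cube enn2real_1)
  then show ?thesis using True by (simp add: vec_of_int_0 set_integral_const emeasure_unit_cube)
next
  case False
  then obtain i where i: "m $ i \<noteq> 0" by (auto simp: vec_eq_iff)
  \<comment> \<open>a translation that shifts the phase by half a period\<close>
  define y :: "real ^ 'n" where "y = axis i (1 / (2 * real_of_int (m $ i)))"
  have y: "y \<bullet> vec_of_int m = 1 / 2"
    using i by (simp add: y_def inner_axis' vec_of_int_def)
  let ?e = "\<lambda>x. cis (2 * pi * (x \<bullet> vec_of_int m))"
  have e: "?e (y + x) = - ?e x" for x
    by (simp add: inner_add_left y distrib_left cis_mult[symmetric])
  have per: "?e (x + vec_of_int k) = ?e x" for x k by (rule cis_add_lattice)
  have cont: "continuous_on UNIV ?e" by (intro continuous_intros)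
  have int: "integrable lborel (\<lambda>x. indicat_real (cbox 0 1) x *\<^sub>R ?e x)"
    using set_integrable_cbox[OF cont] by (simp add: set_integrable_def)
  have "(LINT x:cbox 0 1|lborel. Re (?e x)) = 0"
  proof (rule antiperiodic_integral_zero[where y=y])
    show "continuous_on UNIV (\<lambda>x. Re (?e x))" by (intro continuous_intros)
  qed (use e per in \<open>auto simp del: cis.sel\<close>, use abs_Re_le_cmod norm_cis in metis)
  moreover have "(LINT x:cbox 0 1|lborel. Im (?e x)) = 0"
  proof (rule antiperiodic_integral_zero[where y=y])
    show "continuous_on UNIV (\<lambda>x. Im (?e x))" by (intro continuous_intros)
  qed (use e per in \<open>auto simp del: cis.sel\<close>, use abs_Im_le_cmod norm_cis in metis)
  ultimately have "Re (LINT x:cbox 0 1|lborel. ?e x) = 0" "Im (LINT x:cbox 0 1|lborel. ?e x) = 0"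
    using integral_Re[OF int] integral_Im[OF int] by (auto simp: set_lebesgue_integral_def simp del: cis.sel)
  then show ?thesis using False by (simp add: complex_eq_iff)
qed

lemma fourier_coeff_trig_poly:
  fixes K :: "(int ^ 'n) set"
  assumes K: "finite K"
  shows "fourier_coeff (\<lambda>x. \<Sum>k\<in>K. a k * cis (2 * pi * (x \<bullet> vec_of_int k))) j = (if j \<in> K then a j else 0)"
proof -
  have "fourier_coeff (\<lambda>x. \<Sum>k\<in>K. a k * cis (2 * pi * (x \<bullet> vec_of_int k))) j
     = (LINT x:cbox 0 1|lborel. (\<Sum>k\<in>K. a k * cis (2 * pi * (x \<bullet> vec_of_int (k - j)))))"
    unfolding fourier_coeff_def
    by (simp add: sum_distrib_right mult.assoc cis_mult vec_of_int_diff inner_diff_right right_diff_distrib)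
  also have "\<dots> = (\<Sum>k\<in>K. (LINT x:cbox 0 1|lborel. a k * cis (2 * pi * (x \<bullet> vec_of_int (k - j)))))"
    by (intro set_lebesgue_integral_sum set_integrable_cbox continuous_intros)
  also have "\<dots> = (\<Sum>k\<in>K. a k * (if k = j then 1 else 0))"
    by (subst set_integral_mult_right) (simp add: integral_character)
  also have "\<dots> = (if j \<in> K then a j else 0)"
    using K by (simp add: sum.delta if_distrib cong: if_cong)
  finally show ?thesis .
qed

lemma
  assumes "trig_poly u"
  shows finite_fourier_supp: "finite (fourier_supp u)"
    and trig_poly_fourier_expansion:
      "u x = (\<Sum>k\<in>fourier_supp u. fourier_coeff u k * cis (2 * pi * (x \<bullet> vec_of_int k)))"
proof -
  obtain K a where K: "finite K" and u: "u = (\<lambda>x. \<Sum>k\<in>K. a k * cis (2 * pi * (x \<bullet> vec_of_int k)))"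
    using assms by (auto simp: trig_poly_def)
  have c: "fourier_coeff u j = (if j \<in> K then a j else 0)" for j
    unfolding u by (rule fourier_coeff_trig_poly[OF K])
  have sub: "fourier_supp u \<subseteq> K" by (auto simp: fourier_supp_def c)
  then show "finite (fourier_supp u)" using K finite_subset by auto
  have "u x = (\<Sum>k\<in>K. fourier_coeff u k * cis (2 * pi * (x \<bullet> vec_of_int k)))"
    by (subst u) (simp add: c)
  also have "\<dots> = (\<Sum>k\<in>fourier_supp u. fourier_coeff u k * cis (2 * pi * (x \<bullet> vec_of_int k)))"
    using sub K by (intro sum.mono_neutral_right) (auto simp: fourier_supp_def)
  finally show "u x = (\<Sum>k\<in>fourier_supp u. fourier_coeff u k * cis (2 * pi * (x \<bullet> vec_of_int k)))" .
qed

lemma torus_parseval: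
  assumes "trig_poly u"
  shows "torus_norm2_sq u = ennreal (\<Sum>k\<in>fourier_supp u. (cmod (fourier_coeff u k))\<^sup>2)"
proof -
  let ?S = "fourier_supp u" and ?c = "fourier_coeff u"
  let ?e = "\<lambda>k x. cis (2 * pi * (x \<bullet> vec_of_int k))"
  note fin = finite_fourier_supp[OF assms] and ex = trig_poly_fourier_expansion[OF assms]
  have "continuous_on UNIV (\<lambda>x. \<Sum>k\<in>?S. ?c k * ?e k x)"
    by (intro continuous_intros)
  then have cont: "continuous_on UNIV u"
    by (simp only: ex[symmetric])
  have int: "set_integrable lborel (cbox 0 1) (\<lambda>x. (cmod (u x))\<^sup>2)"
    by (intro set_integrable_cbox continuous_intros cont)
  have sq: "complex_of_real ((cmod (u x))\<^sup>2) = (\<Sum>k\<in>?S. cnj (?c k) * (u x * cis (- (2 * pi * (x \<bullet> vec_of_int k)))))" for x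
  proof -
    have "cnj (u x) = (\<Sum>k\<in>?S. cnj (?c k) * cis (- (2 * pi * (x \<bullet> vec_of_int k))))"
      by (subst ex) (simp add: cis_cnj)
    then show ?thesis
      by (simp add: complex_norm_square sum_distrib_left mult_ac del: of_real_power)
  qed
  have "complex_of_real (LINT x:cbox 0 1|lborel. (cmod (u x))\<^sup>2)
      = (LINT x:cbox 0 1|lborel. complex_of_real ((cmod (u x))\<^sup>2))"
    by (rule set_integral_complex_of_real[symmetric])
  also have "\<dots> = (\<Sum>k\<in>?S. (LINT x:cbox 0 1|lborel. cnj (?c k) * (u x * cis (- (2 * pi * (x \<bullet> vec_of_int k))))))"
    unfolding sq by (intro set_lebesgue_integral_sum set_integrable_cbox continuous_intros cont)
  also have "\<dots> = (\<Sum>k\<in>?S. cnj (?c k) * ?c k)"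
    by (subst set_integral_mult_right) (simp add: fourier_coeff_def)
  also have "\<dots> = complex_of_real (\<Sum>k\<in>?S. (cmod (?c k))\<^sup>2)"
    by (simp add: complex_norm_square mult.commute del: of_real_power)
  finally have val: "(LINT x:cbox 0 1|lborel. (cmod (u x))\<^sup>2) = (\<Sum>k\<in>?S. (cmod (?c k))\<^sup>2)"
    by (simp only: of_real_eq_iff)
  have "torus_norm2_sq u = ennreal (LINT x:cbox 0 1|lborel. (cmod (u x))\<^sup>2)"
    using int unfolding torus_norm2_sq_def set_integrable_def set_lebesgue_integral_def
    by (subst nn_integral_eq_integral[symmetric]) (auto intro!: nn_integral_cong split: split_indicator)
  then show ?thesis by (simp add: val)
qed

definition schroedinger_poly ::
    "(int ^ 'n) set \<Rightarrow> (int ^ 'n \<Rightarrow> complex) \<Rightarrow> real ^ 'n \<Rightarrow> real \<Rightarrow> complex" where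
  "schroedinger_poly K a x t =
     (\<Sum>k\<in>K. a k * cis (2 * pi * (x \<bullet> vec_of_int k + t * (norm (vec_of_int k :: real ^ 'n))\<^sup>2)))"

lemma torus_solution_eq:
  fixes u :: "real ^ 'n \<Rightarrow> complex"
  assumes "trig_poly u"
  shows "torus_solution u x t = schroedinger_poly (fourier_supp u) (fourier_coeff u) x t"
proof -
  have "torus_solution u x t = (\<Sum>\<^sub>\<infinity>k\<in>fourier_supp u. fourier_coeff u k *
     cis (2 * pi * (x \<bullet> vec_of_int k + t * (norm (vec_of_int k :: real ^ 'n))\<^sup>2)))"
    unfolding torus_solution_def by (rule infsum_cong_neutral) (auto simp: fourier_supp_def)
  then show ?thesis
    using finite_fourier_supp[OF assms] by (simp add: schroedinger_poly_def)
qed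

lemma schroedinger_poly_periodic:
  fixes K :: "(int ^ 'n) set"
  shows
  "schroedinger_poly K a (x + vec_of_int m) t = schroedinger_poly K a x t"
  unfolding schroedinger_poly_def distrib_left cis_mult[symmetric] cis_add_lattice ..

section \<open>Wave packets at lattice frequencies\<close>

definition bump :: "real ^ 'n \<Rightarrow> real" where
  "bump \<xi> = max 0 (1 - norm \<xi>)"

lemma bump_nonneg [simp]: "0 \<le> bump \<xi>" and bump_le_1: "bump \<xi> \<le> 1"
  and bump_eq_0: "norm \<xi> \<ge> 1 \<Longrightarrow> bump \<xi> = 0"
  by (auto simp: bump_def)

lemma continuous_bump: "continuous_on A bump"
  unfolding bump_def[abs_def] by (intro continuous_intros)

lemma bump_measurable [measurable]: "bump \<in> borel_measurable borel"
  by (intro borel_measurable_continuous_onI continuous_bump)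

lemma bump_integrable: "integrable lborel (bump :: real ^ 'n \<Rightarrow> real)"
proof -
  have "integrable lborel (\<lambda>x::real ^ 'n. indicat_real (cball 0 1) x *\<^sub>R bump x)"
    by (intro borel_integrable_compact continuous_bump compact_cball)
  moreover have "(\<lambda>x::real ^ 'n. indicat_real (cball 0 1) x *\<^sub>R bump x) = bump"
    by (auto simp: indicator_def bump_eq_0 fun_eq_iff)
  ultimately show ?thesis by simp
qed

definition bump_mass :: "'n::finite itself \<Rightarrow> ennreal" where
  "bump_mass _ = (\<integral>\<^sup>+\<eta>. ennreal ((bump (\<eta> :: real ^ 'n))\<^sup>2) \<partial>lborel)"

lemma bump_mass_eq: "bump_mass TYPE('n) = norm2_sq (\<lambda>\<xi> :: real ^ 'n. complex_of_real (bump \<xi>))"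
  by (simp add: bump_mass_def norm2_sq_def)

lemma bump_mass_finite: "bump_mass TYPE('n::finite) < \<infinity>"
proof -
  have "bump_mass TYPE('n) \<le> (\<integral>\<^sup>+\<eta>. ennreal (bump (\<eta> :: real ^ 'n)) \<partial>lborel)"
    unfolding bump_mass_def
    by (intro nn_integral_mono ennreal_leI) (simp add: power2_eq_square mult_left_le bump_le_1)
  also have "\<dots> < \<infinity>" using bump_integrable by (subst nn_integral_eq_integral) auto
  finally show ?thesis .
qed

lemma bump_mass_pos: "bump_mass TYPE('n::finite) \<noteq> 0"
proof
  assume "bump_mass TYPE('n) = 0"
  then have "AE \<eta> in lborel. ennreal ((bump (\<eta> :: real ^ 'n))\<^sup>2) = 0"
    unfolding bump_mass_def by (subst (asm) nn_integral_0_iff_AE) auto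
  then have "AE \<eta> in lborel. \<eta> \<notin> ball (0 :: real ^ 'n) 1"
    by eventually_elim (auto simp: bump_def max_def split: if_splits)
  then have "ball (0 :: real ^ 'n) 1 \<in> null_sets lborel"
    by (subst (asm) AE_iff_null_sets[symmetric]) auto
  then show False
    using negligible_iff_null_sets null_sets_completionI open_not_negligible[of "ball (0 :: real ^ 'n) 1"] by auto
qed

text \<open>
  The Fourier transform of the Euclidean datum: every frequency \<open>k\<close> of the periodic datum is spread over
  the ball of radius \<open>\<epsilon>\<close> around it.
\<close>
definition packets ::
    "real \<Rightarrow> (int ^ 'n) set \<Rightarrow> (int ^ 'n \<Rightarrow> complex) \<Rightarrow> real ^ 'n \<Rightarrow> complex" where
  "packets \<epsilon> K a \<xi> = (\<Sum>k\<in>K. a k * of_real (bump ((1 / \<epsilon>) *\<^sub>R (\<xi> - vec_of_int k))))"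

lemma bump_scaled_eq_0:
  "\<epsilon> > 0 \<Longrightarrow> norm (\<xi> - c) \<ge> \<epsilon> \<Longrightarrow> bump ((1 / \<epsilon>) *\<^sub>R (\<xi> - c)) = 0"
  by (rule bump_eq_0) (simp only: norm_scaleR, simp add: field_simps)

lemma bump_scaled_integrable:
  assumes "\<epsilon> > 0"
  shows "integrable lborel (\<lambda>\<xi> :: real ^ 'n. bump ((1 / \<epsilon>) *\<^sub>R (\<xi> - c)))"
  using lborel_integrable_affine[OF bump_integrable, of "1 / \<epsilon>" "- ((1 / \<epsilon>) *\<^sub>R c)"] assms
  by (simp add: scaleR_diff_right)

lemma continuous_packets: "continuous_on UNIV (packets \<epsilon> K a)"
  unfolding packets_def[abs_def]
  by (intro continuous_intros continuous_on_compose2[OF continuous_bump[of UNIV]]) auto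

lemma packets_measurable [measurable]: "packets \<epsilon> K a \<in> borel_measurable borel"
  by (intro borel_measurable_continuous_onI continuous_packets)

lemma packets_integrable: "\<epsilon> > 0 \<Longrightarrow> integrable lborel (packets \<epsilon> K a)"
  unfolding packets_def[abs_def]
  by (intro Bochner_Integration.integrable_sum integrable_mult_right)
     (simp add: bump_scaled_integrable)

lemma packets_bounded: "cmod (packets \<epsilon> K a \<xi>) \<le> (\<Sum>k\<in>K. cmod (a k))"
  unfolding packets_def
  by (rule order_trans[OF norm_sum sum_mono]) (simp add: norm_mult mult_left_le bump_le_1)

lemma norm_vec_of_int_ge_1:
  assumes "k \<noteq> l"
  shows "norm (vec_of_int k - vec_of_int l :: real ^ 'n) \<ge> 1"
proof -
  obtain i where i: "k $ i \<noteq> l $ i" using assms by (auto simp: vec_eq_iff)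
  have "1 \<le> \<bar>real_of_int (k $ i) - real_of_int (l $ i)\<bar>" using i by linarith
  also have "\<dots> = \<bar>(vec_of_int k - vec_of_int l :: real ^ 'n) $ i\<bar>" by (simp add: vec_of_int_def)
  also have "\<dots> \<le> norm (vec_of_int k - vec_of_int l :: real ^ 'n)" by (rule component_le_norm_cart)
  finally show ?thesis .
qed

text \<open>
  For \<open>\<epsilon> \<le> 1 / 2\<close> bumps around distinct lattice points do not overlap, so there are no cross terms.
\<close>
lemma cmod_packets_sq:
  fixes K :: "(int ^ 'n) set"
  assumes K: "finite K" and \<epsilon>: "0 < \<epsilon>" "\<epsilon> \<le> 1 / 2"
  shows "(cmod (packets \<epsilon> K a \<xi>))\<^sup>2 = (\<Sum>k\<in>K. (cmod (a k))\<^sup>2 * (bump ((1 / \<epsilon>) *\<^sub>R (\<xi> - vec_of_int k)))\<^sup>2)"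
proof (cases "\<exists>k\<in>K. norm (\<xi> - vec_of_int k) < \<epsilon>")
  case True
  then obtain l where l: "l \<in> K" "norm (\<xi> - vec_of_int l) < \<epsilon>" by blast
  have z: "bump ((1 / \<epsilon>) *\<^sub>R (\<xi> - vec_of_int k)) = 0" if "k \<noteq> l" for k
  proof (rule bump_scaled_eq_0[OF \<epsilon>(1)])
    have "1 \<le> norm (vec_of_int k - vec_of_int l :: real ^ 'n)" by (rule norm_vec_of_int_ge_1[OF that])
    also have "\<dots> \<le> norm (\<xi> - vec_of_int l) + norm (\<xi> - vec_of_int k)"
      using norm_triangle_ineq4[of "\<xi> - vec_of_int l" "\<xi> - vec_of_int k"] by simp
    finally show "\<epsilon> \<le> norm (\<xi> - vec_of_int k)" using l \<epsilon> by linarith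
  qed
  have "packets \<epsilon> K a \<xi> = a l * of_real (bump ((1 / \<epsilon>) *\<^sub>R (\<xi> - vec_of_int l)))"
    unfolding packets_def using K l z by (subst sum.remove[of _ l]) auto
  moreover have "(\<Sum>k\<in>K. (cmod (a k))\<^sup>2 * (bump ((1 / \<epsilon>) *\<^sub>R (\<xi> - vec_of_int k)))\<^sup>2)
      = (cmod (a l))\<^sup>2 * (bump ((1 / \<epsilon>) *\<^sub>R (\<xi> - vec_of_int l)))\<^sup>2"
    using K l z by (subst sum.remove[of _ l]) auto
  ultimately show ?thesis by (simp add: norm_mult power_mult_distrib)
next
  case False
  then have "bump ((1 / \<epsilon>) *\<^sub>R (\<xi> - vec_of_int k)) = 0" if "k \<in> K" for k
    using that by (intro bump_scaled_eq_0 \<epsilon>) auto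
  then show ?thesis by (simp add: packets_def)
qed

lemma nn_integral_bump_scaled:
  fixes c :: "real ^ 'n"
  assumes \<epsilon>: "0 < \<epsilon>"
  shows "(\<integral>\<^sup>+\<xi>. ennreal ((bump ((1 / \<epsilon>) *\<^sub>R (\<xi> - c)))\<^sup>2) \<partial>lborel) = ennreal (\<epsilon> ^ CARD('n)) * bump_mass TYPE('n)"
  using nn_integral_lborel_affine[of "\<lambda>\<xi>. ennreal ((bump ((1 / \<epsilon>) *\<^sub>R (\<xi> - c)))\<^sup>2)" \<epsilon> c] \<epsilon>
  by (simp add: bump_mass_def)

text \<open>
  The right-hand sides of both Euclidean inequalities reduce to this: against the packets, a function
  of the velocity is seen only within \<open>\<epsilon>\<close> of the lattice points in \<open>K\<close>.
\<close>
lemma nn_integral_packets_le: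
  fixes K :: "(int ^ 'n) set" and h :: "real ^ 'n \<Rightarrow> ennreal"
  assumes K: "finite K" and \<epsilon>: "0 < \<epsilon>" "\<epsilon> \<le> 1 / 2"
    and h: "\<And>v k. k \<in> K \<Longrightarrow> norm (v - vec_of_int k) \<le> \<epsilon> \<Longrightarrow> h v \<le> H k"
  shows "(\<integral>\<^sup>+v. ennreal ((cmod (packets \<epsilon> K a v))\<^sup>2) * h v \<partial>lborel)
    \<le> ennreal (\<epsilon> ^ CARD('n)) * bump_mass TYPE('n) * (\<Sum>k\<in>K. ennreal ((cmod (a k))\<^sup>2) * H k)"
proof -
  let ?b = "\<lambda>k v. ennreal ((bump ((1 / \<epsilon>) *\<^sub>R (v - vec_of_int k)))\<^sup>2)"
  have "(\<integral>\<^sup>+v. ennreal ((cmod (packets \<epsilon> K a v))\<^sup>2) * h v \<partial>lborel)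
      \<le> (\<integral>\<^sup>+v. (\<Sum>k\<in>K. ennreal ((cmod (a k))\<^sup>2) * H k * ?b k v) \<partial>lborel)"
  proof (intro nn_integral_mono)
    fix v
    have "ennreal ((cmod (packets \<epsilon> K a v))\<^sup>2) * h v = (\<Sum>k\<in>K. ennreal ((cmod (a k))\<^sup>2) * ?b k v * h v)"
      unfolding cmod_packets_sq[OF K \<epsilon>]
      by (subst sum_ennreal[symmetric]) (auto simp: ennreal_mult sum_distrib_right)
    also have "\<dots> \<le> (\<Sum>k\<in>K. ennreal ((cmod (a k))\<^sup>2) * H k * ?b k v)"
    proof (intro sum_mono)
      fix k assume k: "k \<in> K"
      show "ennreal ((cmod (a k))\<^sup>2) * ?b k v * h v \<le> ennreal ((cmod (a k))\<^sup>2) * H k * ?b k v"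
      proof (cases "norm (v - vec_of_int k) \<le> \<epsilon>")
        case True
        from mult_left_mono[OF h[OF k this], of "ennreal ((cmod (a k))\<^sup>2) * ?b k v"]
        show ?thesis by (simp add: mult_ac)
      next
        case False
        then show ?thesis using \<epsilon> by (simp add: bump_scaled_eq_0)
      qed
    qed
    finally show "ennreal ((cmod (packets \<epsilon> K a v))\<^sup>2) * h v \<le> (\<Sum>k\<in>K. ennreal ((cmod (a k))\<^sup>2) * H k * ?b k v)" .
  qed
  also have "\<dots> = (\<Sum>k\<in>K. ennreal ((cmod (a k))\<^sup>2) * H k * (ennreal (\<epsilon> ^ CARD('n)) * bump_mass TYPE('n)))"
    by (subst nn_integral_sum) (auto simp: nn_integral_cmult nn_integral_bump_scaled \<epsilon>)
  also have "\<dots> = ennreal (\<epsilon> ^ CARD('n)) * bump_mass TYPE('n) * (\<Sum>k\<in>K. ennreal ((cmod (a k))\<^sup>2) * H k)"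
    by (simp add: sum_distrib_left mult_ac)
  finally show ?thesis .
qed

lemma norm2_sq_packets_le:
  fixes K :: "(int ^ 'n) set"
  assumes "finite K" "0 < \<epsilon>" "\<epsilon> \<le> 1 / 2"
  shows "norm2_sq (packets \<epsilon> K a) \<le> ennreal (\<epsilon> ^ CARD('n)) * bump_mass TYPE('n) * ennreal (\<Sum>k\<in>K. (cmod (a k))\<^sup>2)"
  using nn_integral_packets_le[OF assms, of "\<lambda>_. 1" "\<lambda>_. 1" a]
  by (simp add: norm2_sq_def sum_ennreal)

lemma ess_supp_packets:
  fixes K :: "(int ^ 'n) set"
  assumes K: "finite K" and \<epsilon>: "0 < \<epsilon>"
  shows "ess_supp (packets \<epsilon> K a) \<subseteq> (\<Union>k\<in>K. cball (vec_of_int k) \<epsilon>)"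
proof -
  let ?D = "\<Union>k\<in>K. cball (vec_of_int k) \<epsilon> :: (real ^ 'n) set"
  have "open (- ?D)" using K by (intro open_Compl closed_UN) auto
  moreover have "packets \<epsilon> K a x = 0" if "x \<in> - ?D" for x
    using that \<epsilon> unfolding packets_def
    by (intro sum.neutral ballI) (auto simp: dist_norm norm_minus_commute intro!: bump_scaled_eq_0)
  ultimately have "- ?D \<in> {U. open U \<and> (AE x in lborel. x \<in> U \<longrightarrow> packets \<epsilon> K a x = 0)}" by auto
  then show ?thesis unfolding ess_supp_def by blast
qed

lemma ess_supp_packets_cube:
  fixes K :: "(int ^ 'n) set"
  assumes K: "finite K" and \<epsilon>: "0 < \<epsilon>" "\<epsilon> \<le> 1 / 2" and N: "vec_of_int ` K \<subseteq> cube N"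
  shows "ess_supp (packets \<epsilon> K a) \<subseteq> cube (N + 1)"
proof
  fix v assume "v \<in> ess_supp (packets \<epsilon> K a)"
  then obtain k where k: "k \<in> K" "norm (vec_of_int k - v) \<le> \<epsilon>"
    using ess_supp_packets[OF K \<epsilon>(1), of a] by (auto simp: dist_norm)
  show "v \<in> cube (N + 1)"
    unfolding cube_def
  proof (intro CollectI allI)
    fix i
    have "\<bar>(vec_of_int k - v) $ i\<bar> \<le> \<epsilon>" using component_le_norm_cart k(2) order_trans by blast
    moreover have "vec_of_int k $ i \<in> {-N..N}" using N k(1) by (auto simp: cube_def)
    ultimately show "v $ i \<in> {-(N + 1)..N + 1}" using \<epsilon> by auto
  qed
qed

text \<open>
  The amplitude of the wave packet at frequency \<open>k\<close>, as a function of the slow variable \<open>X = \<epsilon> x\<close>. The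
  packet travels with velocity \<open>- 2 k\<close>, which in slow variables is a displacement by \<open>2 \<epsilon> t k\<close>, and it
  disperses with phase \<open>t \<epsilon>\<^sup>2 \<bar>\<eta>\<bar>\<^sup>2\<close>; both effects vanish in the limit.
\<close>
definition envelope :: "real \<Rightarrow> int ^ 'n \<Rightarrow> real ^ 'n \<Rightarrow> real \<Rightarrow> complex" where
  "envelope \<epsilon> k X t = (LINT \<eta>|lborel. of_real (bump \<eta>) *
     cis (2 * pi * ((X + (2 * \<epsilon> * t) *\<^sub>R vec_of_int k) \<bullet> \<eta> + t * \<epsilon>\<^sup>2 * (norm \<eta>)\<^sup>2)))"

lemma envelope_measurable [measurable]:
  assumes [measurable]: "f \<in> borel_measurable M" "g \<in> borel_measurable M"
  shows "(\<lambda>p. envelope \<epsilon> k (f p) (g p)) \<in> borel_measurable M"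
  unfolding envelope_def by measurable

text \<open>
  Substitute \<open>\<xi> = k + \<epsilon> \<eta>\<close> in the integral for each packet: its phase splits into the phase of the periodic
  wave of frequency \<open>k\<close> and that of the envelope.
\<close>
lemma solution_packets:
  fixes K :: "(int ^ 'n) set"
  assumes \<epsilon>: "0 < \<epsilon>"
  shows "solution (packets \<epsilon> K a) x t = of_real (\<epsilon> ^ CARD('n)) *
    (\<Sum>k\<in>K. a k * cis (2 * pi * (x \<bullet> vec_of_int k + t * (norm (vec_of_int k :: real ^ 'n))\<^sup>2))
       * envelope \<epsilon> k (\<epsilon> *\<^sub>R x) t)"
proof -
  let ?e = "\<lambda>\<xi>. cis (2 * pi * (x \<bullet> \<xi> + t * (norm \<xi>)\<^sup>2))"
  let ?f = "\<lambda>k \<xi>. of_real (bump ((1 / \<epsilon>) *\<^sub>R (\<xi> - vec_of_int k))) * ?e \<xi>"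
  have int: "integrable lborel (?f k)" for k
  proof (rule Bochner_Integration.integrable_bound[OF bump_scaled_integrable[OF \<epsilon>, of "vec_of_int k"]])
    show "AE \<xi> in lborel. norm (?f k \<xi>) \<le> norm (bump ((1 / \<epsilon>) *\<^sub>R (\<xi> - vec_of_int k)))"
      by (simp add: norm_mult)
  qed measurable
  have phase: "x \<bullet> (c + \<epsilon> *\<^sub>R \<eta>) + t * (norm (c + \<epsilon> *\<^sub>R \<eta>))\<^sup>2
      = (x \<bullet> c + t * (norm c)\<^sup>2) + ((\<epsilon> *\<^sub>R x + (2 * \<epsilon> * t) *\<^sub>R c) \<bullet> \<eta> + t * \<epsilon>\<^sup>2 * (norm \<eta>)\<^sup>2)" for c \<eta>
    unfolding power2_norm_eq_inner
    by (simp add: inner_add_left inner_add_right inner_commute algebra_simps power2_eq_square)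
  have "(LINT \<xi>|lborel. ?f k \<xi>) = of_real (\<epsilon> ^ CARD('n)) * (?e (vec_of_int k) * envelope \<epsilon> k (\<epsilon> *\<^sub>R x) t)" for k
  proof -
    have "(LINT \<xi>|lborel. ?f k \<xi>) = \<epsilon> ^ CARD('n) *\<^sub>R (LINT \<eta>|lborel. ?f k (vec_of_int k + \<epsilon> *\<^sub>R \<eta>))"
      using lborel_integral_affine[of "?f k" \<epsilon> "vec_of_int k"] \<epsilon> by simp
    also have "(\<lambda>\<eta>. ?f k (vec_of_int k + \<epsilon> *\<^sub>R \<eta>)) = (\<lambda>\<eta>. ?e (vec_of_int k) * (of_real (bump \<eta>) *
        cis (2 * pi * ((\<epsilon> *\<^sub>R x + (2 * \<epsilon> * t) *\<^sub>R vec_of_int k) \<bullet> \<eta> + t * \<epsilon>\<^sup>2 * (norm \<eta>)\<^sup>2))))"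
      using \<epsilon> unfolding phase distrib_left[of "2 * pi"] cis_mult[symmetric] by (simp add: mult_ac)
    finally show ?thesis by (simp add: envelope_def scaleR_conv_of_real)
  qed
  note packet = this
  have "solution (packets \<epsilon> K a) x t = (LINT \<xi>|lborel. (\<Sum>k\<in>K. a k * ?f k \<xi>))"
    unfolding solution_def packets_def by (simp add: sum_distrib_right mult.assoc)
  also have "\<dots> = (\<Sum>k\<in>K. a k * (LINT \<xi>|lborel. ?f k \<xi>))"
    using int by (subst Bochner_Integration.integral_sum) auto
  finally show ?thesis unfolding packet by (simp add: sum_distrib_left mult_ac)
qed

lemma envelope_tendsto:
  fixes k :: "int ^ 'n"
  assumes \<epsilon>: "\<epsilon> \<longlonglongrightarrow> 0" and X: "X \<longlonglongrightarrow> X0"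
  shows "(\<lambda>m. envelope (\<epsilon> m) k (X m) t) \<longlonglongrightarrow> inverse_fourier (\<lambda>\<eta>. of_real (bump \<eta>)) X0"
  unfolding envelope_def inverse_fourier_eq
proof (rule integral_dominated_convergence[where w=bump])
  show "AE \<eta> in lborel. (\<lambda>m. complex_of_real (bump \<eta>) *
       cis (2 * pi * ((X m + (2 * \<epsilon> m * t) *\<^sub>R vec_of_int k) \<bullet> \<eta> + t * (\<epsilon> m)\<^sup>2 * (norm \<eta>)\<^sup>2)))
     \<longlonglongrightarrow> complex_of_real (bump \<eta>) * cis (2 * pi * (X0 \<bullet> \<eta>))"
  proof (intro AE_I2)
    fix \<eta> :: "real ^ 'n"
    have "(\<lambda>m. complex_of_real (bump \<eta>) *
       cis (2 * pi * ((X m + (2 * \<epsilon> m * t) *\<^sub>R vec_of_int k) \<bullet> \<eta> + t * (\<epsilon> m)\<^sup>2 * (norm \<eta>)\<^sup>2)))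
     \<longlonglongrightarrow> complex_of_real (bump \<eta>) * cis (2 * pi * ((X0 + (2 * 0 * t) *\<^sub>R vec_of_int k) \<bullet> \<eta> + t * 0\<^sup>2 * (norm \<eta>)\<^sup>2))"
      by (intro tendsto_intros \<epsilon> X)
    then show "(\<lambda>m. complex_of_real (bump \<eta>) *
       cis (2 * pi * ((X m + (2 * \<epsilon> m * t) *\<^sub>R vec_of_int k) \<bullet> \<eta> + t * (\<epsilon> m)\<^sup>2 * (norm \<eta>)\<^sup>2)))
     \<longlonglongrightarrow> complex_of_real (bump \<eta>) * cis (2 * pi * (X0 \<bullet> \<eta>))" by simp
  qed
qed (use bump_integrable in \<open>auto simp: norm_mult\<close>)

lemma norm_lattice_part_diff_le:
  fixes z :: "real ^ 'n"
  shows "norm (lattice_part z - z) \<le> CARD('n)"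
proof -
  have "norm (lattice_part z - z) \<le> (\<Sum>i\<in>UNIV. \<bar>(lattice_part z - z) $ i\<bar>)" by (rule norm_le_l1_cart)
  also have "\<dots> \<le> (\<Sum>i\<in>(UNIV::'n set). 1)"
    by (intro sum_mono) (simp add: lattice_part_def vec_of_int_def, linarith)
  finally show ?thesis by simp
qed

lemma scaled_lattice_part_tendsto:
  fixes Z y :: "real ^ 'n"
  assumes \<epsilon>: "\<epsilon> \<longlonglongrightarrow> 0" and pos: "\<And>m. \<epsilon> m > 0"
  shows "(\<lambda>m. \<epsilon> m *\<^sub>R (lattice_part ((1 / \<epsilon> m) *\<^sub>R Z) + y)) \<longlonglongrightarrow> Z"
proof -
  have "(\<lambda>m. \<epsilon> m *\<^sub>R (lattice_part ((1 / \<epsilon> m) *\<^sub>R Z) + y) - Z) \<longlonglongrightarrow> 0"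
  proof (rule Lim_null_comparison)
    show "\<forall>\<^sub>F m in sequentially. norm (\<epsilon> m *\<^sub>R (lattice_part ((1 / \<epsilon> m) *\<^sub>R Z) + y) - Z) \<le> \<epsilon> m * (CARD('n) + norm y)"
    proof (intro always_eventually allI)
      fix m
      have "\<epsilon> m *\<^sub>R (lattice_part ((1 / \<epsilon> m) *\<^sub>R Z) + y) - Z
          = \<epsilon> m *\<^sub>R ((lattice_part ((1 / \<epsilon> m) *\<^sub>R Z) - (1 / \<epsilon> m) *\<^sub>R Z) + y)"
        using pos[of m] by (simp add: scaleR_add_right scaleR_diff_right)
      moreover have "norm ((lattice_part ((1 / \<epsilon> m) *\<^sub>R Z) - (1 / \<epsilon> m) *\<^sub>R Z) + y) \<le> CARD('n) + norm y"
        using norm_lattice_part_diff_le norm_triangle_le add_right_mono by blast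
      ultimately show "norm (\<epsilon> m *\<^sub>R (lattice_part ((1 / \<epsilon> m) *\<^sub>R Z) + y) - Z) \<le> \<epsilon> m * (CARD('n) + norm y)"
        using pos[of m] by (simp add: mult_left_mono)
    qed
    have "(\<lambda>m. \<epsilon> m * (CARD('n) + norm y)) \<longlonglongrightarrow> 0 * (CARD('n) + norm y)"
      by (intro tendsto_intros \<epsilon>)
    then show "(\<lambda>m. \<epsilon> m * (CARD('n) + norm y)) \<longlonglongrightarrow> 0" by simp
  qed
  then show ?thesis by (simp add: LIM_zero_iff)
qed

section \<open>The limit of concentrating packets\<close>
lemma nn_integral_le_liminf:
  assumes "\<And>m. F m \<in> borel_measurable M" and "\<And>x. G x \<le> liminf (\<lambda>m. F m x)"
  shows "(\<integral>\<^sup>+x. G x \<partial>M) \<le> liminf (\<lambda>m. \<integral>\<^sup>+x. F m x \<partial>M)"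
  using nn_integral_mono[of M G "\<lambda>x. liminf (\<lambda>m. F m x)"] nn_integral_liminf[of F M] assms
  by (metis order_trans)

text \<open>
  The Euclidean X-ray transform integrates over all times. Restricting the weight to \<open>[0,1]\<close> leaves
  exactly one temporal period, and does not affect the weighted mass.
\<close>
definition time_cut :: "('a \<times> real \<Rightarrow> real) \<Rightarrow> 'a \<times> real \<Rightarrow> real" where
  "time_cut W p = indicat_real {0..1} (snd p) * W p"

lemma xray_time_cut:
  "xray (time_cut W) x v = (\<integral>\<^sup>+t\<in>{0..1}. ennreal (W (x - (2 * t) *\<^sub>R v, t)) \<partial>lborel)"
  unfolding xray_def by (intro nn_integral_cong) (simp add: time_cut_def indicator_def)

lemma weight_time_cut:
  fixes W :: "('a::euclidean_space) \<times> real \<Rightarrow> real"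
  assumes [measurable]: "W \<in> borel_measurable borel" and W: "\<And>p. 0 \<le> W p" "\<And>p. W p \<le> B"
  shows "weight (time_cut W)"
  unfolding weight_def
proof (intro conjI allI impI)
  have [measurable]: "(snd :: 'a \<times> real \<Rightarrow> real) \<in> borel_measurable borel"
    by (intro borel_measurable_continuous_onI continuous_intros)
  show m[measurable]: "time_cut W \<in> borel_measurable borel"
    unfolding time_cut_def[abs_def] by measurable
  show "0 \<le> time_cut W p" for p using W by (simp add: time_cut_def)
  fix C :: "('a \<times> real) set" assume C: "compact C"
  have B0: "B \<ge> 0" using W order_trans by blast
  show "set_integrable lborel C (time_cut W)"
    unfolding set_integrable_def
  proof (rule Bochner_Integration.integrable_bound)
    show "integrable lborel (\<lambda>x. B * indicat_real C x)"
      using C emeasure_bounded_finite[OF compact_imp_bounded[OF C]]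
      by (intro integrable_mult_right integrable_real_indicator) (auto dest: compact_imp_closed)
    show "AE x in lborel. norm (indicat_real C x *\<^sub>R time_cut W x) \<le> norm (B * indicat_real C x)"
      using W B0 by (auto simp: time_cut_def indicator_def)
    show "(\<lambda>x. indicat_real C x *\<^sub>R time_cut W x) \<in> borel_measurable lborel"
      using compact_imp_closed[OF C] by simp
  qed
qed

definition poly_mass ::
    "(int ^ 'n) set \<Rightarrow> (int ^ 'n \<Rightarrow> complex) \<Rightarrow> ((real ^ 'n) \<times> real \<Rightarrow> real) \<Rightarrow> ennreal" where
  "poly_mass K a w = (\<integral>\<^sup>+t\<in>{0..1}. (\<integral>\<^sup>+x\<in>cbox 0 1.
     ennreal ((cmod (schroedinger_poly K a x t))\<^sup>2 * w (x, t)) \<partial>lborel) \<partial>lborel)"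

lemma schroedinger_poly_measurable [measurable]:
  assumes [measurable]: "f \<in> borel_measurable M" "g \<in> borel_measurable M"
  shows "(\<lambda>p. schroedinger_poly K a (f p) (g p)) \<in> borel_measurable M"
  unfolding schroedinger_poly_def by measurable

text \<open>
  The solution at the point \<open>lattice_part (Z / \<epsilon>) + y\<close>, up to a lattice translation of the periodic
  factors and the scalar \<open>\<epsilon> ^ CARD('n)\<close>. The slow variable \<open>Z\<close> and the position \<open>y\<close> in the cell become
  independent in the limit.
\<close>
definition blowup ::
    "(int ^ 'n) set \<Rightarrow> (int ^ 'n \<Rightarrow> complex) \<Rightarrow> real \<Rightarrow> real \<Rightarrow> real ^ 'n \<Rightarrow> real ^ 'n \<Rightarrow> complex" where
  "blowup K a \<epsilon> t Z y = (\<Sum>k\<in>K. a k * cis (2 * pi * (y \<bullet> vec_of_int k + t * (norm (vec_of_int k :: real ^ 'n))\<^sup>2))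
       * envelope \<epsilon> k (\<epsilon> *\<^sub>R (lattice_part ((1 / \<epsilon>) *\<^sub>R Z) + y)) t)"

lemma blowup_measurable [measurable]:
  assumes [measurable]: "f \<in> borel_measurable M" "g \<in> borel_measurable M" "h \<in> borel_measurable M"
  shows "(\<lambda>p. blowup K a \<epsilon> (f p) (g p) (h p)) \<in> borel_measurable M"
  unfolding blowup_def by measurable

context
  fixes W :: "(real ^ 'n) \<times> real \<Rightarrow> real" and K :: "(int ^ 'n) set" and a :: "int ^ 'n \<Rightarrow> complex"
  assumes W_meas: "W \<in> borel_measurable borel" and W_nonneg: "\<And>p. 0 \<le> W p"
    and W_per: "\<And>x k t. W (x + vec_of_int k, t) = W (x, t)"
begin

private lemma W_meas': "W \<in> borel_measurable (borel \<Otimes>\<^sub>M borel)"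
  using W_meas by (simp add: borel_prod)

private lemma weighted_mass_packets:
  assumes \<epsilon>: "0 < \<epsilon>"
  shows "weighted_mass (packets \<epsilon> K a) (time_cut W) = ennreal (\<epsilon> ^ CARD('n)) *
    (\<integral>\<^sup>+t. (\<integral>\<^sup>+Z. (\<integral>\<^sup>+y. ennreal ((cmod (blowup K a \<epsilon> t Z y))\<^sup>2 * W (y, t)) * indicator unit_cell y * indicator {0..1} t
       \<partial>lborel) \<partial>lborel) \<partial>lborel)"
proof -
  note [measurable] = W_meas'
  let ?d = "CARD('n)"
  have sol: "cmod (solution (packets \<epsilon> K a) (lattice_part z + y) t) = \<epsilon> ^ ?d * cmod (blowup K a \<epsilon> t (\<epsilon> *\<^sub>R z) y)" for z y t
  proof -
    have "cis (2 * pi * ((lattice_part z + y) \<bullet> vec_of_int k + s)) = cis (2 * pi * (y \<bullet> vec_of_int k + s))" for k s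
      unfolding distrib_left[of "2 * pi"] cis_mult[symmetric] lattice_part_def
      using cis_add_lattice[of y _ k] by (simp add: add.commute)
    then show ?thesis
      unfolding solution_packets[OF \<epsilon>] blowup_def using \<epsilon> by (simp add: norm_mult norm_power)
  qed
  have inner: "(\<integral>\<^sup>+x. ennreal ((cmod (solution (packets \<epsilon> K a) x t))\<^sup>2 * W (x, t)) \<partial>lborel)
      = ennreal (\<epsilon> ^ ?d) * (\<integral>\<^sup>+Z. (\<integral>\<^sup>+y\<in>unit_cell. ennreal ((cmod (blowup K a \<epsilon> t Z y))\<^sup>2 * W (y, t)) \<partial>lborel) \<partial>lborel)" for t
  proof -
    let ?J = "\<lambda>Z. (\<integral>\<^sup>+y\<in>unit_cell. ennreal ((cmod (blowup K a \<epsilon> t Z y))\<^sup>2 * W (y, t)) \<partial>lborel)"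
    have [measurable]: "(\<lambda>x. solution (packets \<epsilon> K a) x t) \<in> borel_measurable borel"
      unfolding solution_packets[OF \<epsilon>] by measurable
    have Wp: "W (lattice_part z + y, t) = W (y, t)" for z y
      using W_per[of y _ t] by (simp add: lattice_part_def add.commute)
    have "(\<integral>\<^sup>+x. ennreal ((cmod (solution (packets \<epsilon> K a) x t))\<^sup>2 * W (x, t)) \<partial>lborel)
        = (\<integral>\<^sup>+z. (\<integral>\<^sup>+y\<in>unit_cell. ennreal ((cmod (solution (packets \<epsilon> K a) (lattice_part z + y) t))\<^sup>2 * W (y, t)) \<partial>lborel) \<partial>lborel)"
      by (subst nn_integral_lattice_unfold) (auto simp: Wp)
    also have "\<dots> = (\<integral>\<^sup>+z. ennreal ((\<epsilon> ^ ?d)\<^sup>2) * ?J (\<epsilon> *\<^sub>R z) \<partial>lborel)"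
      by (subst nn_integral_cmult[symmetric])
         (auto simp: sol power_mult_distrib mult.assoc ennreal_mult W_nonneg simp del: ennreal_power intro!: nn_integral_cong)
    also have "\<dots> = ennreal ((\<epsilon> ^ ?d)\<^sup>2) * (\<integral>\<^sup>+z. ?J (\<epsilon> *\<^sub>R z) \<partial>lborel)"
      by (rule nn_integral_cmult) measurable
    also have "(\<integral>\<^sup>+z. ?J (\<epsilon> *\<^sub>R z) \<partial>lborel) = ennreal ((1 / \<epsilon>) ^ ?d) * (\<integral>\<^sup>+Z. ?J Z \<partial>lborel)"
      using nn_integral_lborel_affine[of "\<lambda>z. ?J (\<epsilon> *\<^sub>R z)" "1 / \<epsilon>" 0] \<epsilon> by simp
    also have "ennreal ((\<epsilon> ^ ?d)\<^sup>2) * (ennreal ((1 / \<epsilon>) ^ ?d) * (\<integral>\<^sup>+Z. ?J Z \<partial>lborel)) = ennreal (\<epsilon> ^ ?d) * (\<integral>\<^sup>+Z. ?J Z \<partial>lborel)"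
      using \<epsilon> unfolding mult.assoc[symmetric] 
      by (subst ennreal_mult[symmetric]) (auto simp: power2_eq_square power_divide)
    finally show ?thesis .
  qed
  have "weighted_mass (packets \<epsilon> K a) (time_cut W)
      = (\<integral>\<^sup>+t\<in>{0..1}. (\<integral>\<^sup>+x. ennreal ((cmod (solution (packets \<epsilon> K a) x t))\<^sup>2 * W (x, t)) \<partial>lborel) \<partial>lborel)"
    unfolding weighted_mass_def time_cut_def by (intro nn_integral_cong) (auto simp: indicator_def)
  also have "\<dots> = (\<integral>\<^sup>+t. ennreal (\<epsilon> ^ ?d) * (\<integral>\<^sup>+Z. (\<integral>\<^sup>+y. ennreal ((cmod (blowup K a \<epsilon> t Z y))\<^sup>2 * W (y, t)) * indicator unit_cell y * indicator {0..1} t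
       \<partial>lborel) \<partial>lborel) \<partial>lborel)"
    unfolding inner by (intro nn_integral_cong) (auto simp: indicator_def)
  also have "\<dots> = ennreal (\<epsilon> ^ ?d) * (\<integral>\<^sup>+t. (\<integral>\<^sup>+Z. (\<integral>\<^sup>+y. ennreal ((cmod (blowup K a \<epsilon> t Z y))\<^sup>2 * W (y, t)) * indicator unit_cell y * indicator {0..1} t
       \<partial>lborel) \<partial>lborel) \<partial>lborel)"
    by (rule nn_integral_cmult) measurable
  finally show ?thesis .
qed

text \<open>
  As \<open>\<epsilon> \<rightarrow> 0\<close> the blown-up solution converges pointwise to the product of the periodic solution in \<open>y\<close> and
  the inverse transform of the bump in \<open>Z\<close>. Fatou's lemma, applied in each of the three variables, turns
  this into a lower bound for the rescaled mass, and by Plancherel the factor \<open>bump_mass\<close> is the same on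
  both sides.
\<close>
lemma poly_mass_le_of_packets:
  assumes bound: "\<And>\<epsilon>. 0 < \<epsilon> \<Longrightarrow> \<epsilon> \<le> 1 / 2 \<Longrightarrow> weighted_mass (packets \<epsilon> K a) (time_cut W)
      \<le> ennreal (\<epsilon> ^ CARD('n)) * bump_mass TYPE('n) * (ennreal (exp (c * \<epsilon>)) * R)"
  shows "poly_mass K a W \<le> R"
proof -
  note [measurable] = W_meas'
  \<comment> \<open>offset by 2 so that \<open>\<epsilon> m \<le> 1 / 2\<close> from the start\<close>
  define \<epsilon> :: "nat \<Rightarrow> real" where "\<epsilon> m = 1 / real (m + 2)" for m
  have \<epsilon>_pos: "\<epsilon> m > 0" and \<epsilon>_le: "\<epsilon> m \<le> 1 / 2" for m by (auto simp: \<epsilon>_def field_simps)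
  have "(\<lambda>m. 1 / real m) \<longlonglongrightarrow> 0" by (rule lim_1_over_n)
  from LIMSEQ_ignore_initial_segment[OF this, of 2] have \<epsilon>_lim: "\<epsilon> \<longlonglongrightarrow> 0"
    by (simp add: \<epsilon>_def[abs_def])
  let ?\<Phi> = "inverse_fourier (\<lambda>\<eta> :: real ^ 'n. complex_of_real (bump \<eta>))"
  let ?P = "schroedinger_poly K a"
  let ?I = "\<lambda>y t. indicator unit_cell y * indicator {0..1::real} t :: ennreal"
  let ?F = "\<lambda>m t Z y. ennreal ((cmod (blowup K a (\<epsilon> m) t Z y))\<^sup>2 * W (y, t)) * indicator unit_cell y * indicator {0..1} t"
  let ?G = "\<lambda>t Z y. ennreal ((cmod (?\<Phi> Z))\<^sup>2) * (ennreal ((cmod (?P y t))\<^sup>2 * W (y, t)) * indicator unit_cell y * indicator {0..1} t)"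
  have ptw: "?G t Z y \<le> liminf (\<lambda>m. ?F m t Z y)" for t Z y
  proof -
    have "(\<lambda>m. blowup K a (\<epsilon> m) t Z y) \<longlonglongrightarrow> (\<Sum>k\<in>K. a k * cis (2 * pi * (y \<bullet> vec_of_int k + t * (norm (vec_of_int k :: real ^ 'n))\<^sup>2)) * ?\<Phi> Z)"
      unfolding blowup_def
      by (intro tendsto_intros envelope_tendsto \<epsilon>_lim scaled_lattice_part_tendsto \<epsilon>_pos)
    also have "(\<Sum>k\<in>K. a k * cis (2 * pi * (y \<bullet> vec_of_int k + t * (norm (vec_of_int k :: real ^ 'n))\<^sup>2)) * ?\<Phi> Z) = ?P y t * ?\<Phi> Z"
      by (simp add: schroedinger_poly_def sum_distrib_right)
    finally have "(\<lambda>m. (cmod (blowup K a (\<epsilon> m) t Z y))\<^sup>2 * W (y, t)) \<longlonglongrightarrow> (cmod (?P y t * ?\<Phi> Z))\<^sup>2 * W (y, t)"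
      by (intro tendsto_intros)
    from tendsto_ennrealI[OF this]
    have "(\<lambda>m. ennreal ((cmod (blowup K a (\<epsilon> m) t Z y))\<^sup>2 * W (y, t)) * ?I y t) \<longlonglongrightarrow> ennreal ((cmod (?P y t * ?\<Phi> Z))\<^sup>2 * W (y, t)) * ?I y t"
      by (intro tendsto_mult_ennreal tendsto_const) (auto simp: indicator_def)
    moreover have "ennreal ((cmod (?P y t * ?\<Phi> Z))\<^sup>2 * W (y, t)) * ?I y t = ?G t Z y"
      by (simp add: norm_mult power_mult_distrib ennreal_mult W_nonneg mult_ac)
    ultimately have "(\<lambda>m. ?F m t Z y) \<longlonglongrightarrow> ?G t Z y" by (simp add: mult.assoc)
    from lim_imp_Liminf[OF _ this] show ?thesis by simp
  qed
  let ?L = "\<integral>\<^sup>+t. (\<integral>\<^sup>+Z. (\<integral>\<^sup>+y. ?G t Z y \<partial>lborel) \<partial>lborel) \<partial>lborel"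
  let ?J = "\<lambda>m. \<integral>\<^sup>+t. (\<integral>\<^sup>+Z. (\<integral>\<^sup>+y. ?F m t Z y \<partial>lborel) \<partial>lborel) \<partial>lborel"
  have "?L \<le> liminf ?J"
    by (intro nn_integral_le_liminf ptw) measurable
  also have "?J m \<le> ennreal (exp (c * \<epsilon> m)) * (bump_mass TYPE('n) * R)" for m
  proof -
    have e: "ennreal (\<epsilon> m ^ CARD('n)) \<noteq> 0" "ennreal (\<epsilon> m ^ CARD('n)) \<noteq> \<infinity>"
      using \<epsilon>_pos[of m] by (auto simp: ennreal_eq_0_iff not_le)
    have "ennreal (\<epsilon> m ^ CARD('n)) * ?J m \<le> ennreal (\<epsilon> m ^ CARD('n)) * (ennreal (exp (c * \<epsilon> m)) * (bump_mass TYPE('n) * R))"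
      using bound[OF \<epsilon>_pos[of m] \<epsilon>_le[of m]] unfolding weighted_mass_packets[OF \<epsilon>_pos] by (simp add: mult_ac)
    then show ?thesis using e by (simp add: ennreal_mult_le_mult_iff)
  qed
  then have "liminf ?J \<le> liminf (\<lambda>m. ennreal (exp (c * \<epsilon> m)) * (bump_mass TYPE('n) * R))"
    by (intro Liminf_mono always_eventually allI)
  also have "(\<lambda>m. ennreal (exp (c * \<epsilon> m)) * (bump_mass TYPE('n) * R)) \<longlonglongrightarrow> ennreal (exp (c * 0)) * (bump_mass TYPE('n) * R)"
    by (intro tendsto_mult_ennreal tendsto_ennrealI tendsto_intros \<epsilon>_lim) auto
  from lim_imp_Liminf[OF _ this]
  have "liminf (\<lambda>m. ennreal (exp (c * \<epsilon> m)) * (bump_mass TYPE('n) * R)) = bump_mass TYPE('n) * R"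
    by simp
  finally have 1: "?L \<le> bump_mass TYPE('n) * R" .
  have "?L = (\<integral>\<^sup>+t. (\<integral>\<^sup>+Z. ennreal ((cmod (?\<Phi> Z))\<^sup>2) *
      (\<integral>\<^sup>+y. ennreal ((cmod (?P y t))\<^sup>2 * W (y, t)) * indicator unit_cell y * indicator {0..1} t \<partial>lborel) \<partial>lborel) \<partial>lborel)"
    by (intro nn_integral_cong nn_integral_cmult) measurable
  also have "\<dots> = (\<integral>\<^sup>+t. norm2_sq ?\<Phi> *
      (\<integral>\<^sup>+y. ennreal ((cmod (?P y t))\<^sup>2 * W (y, t)) * indicator unit_cell y * indicator {0..1} t \<partial>lborel) \<partial>lborel)"
    unfolding norm2_sq_def by (intro nn_integral_cong nn_integral_multc) measurable
  also have "\<dots> = norm2_sq ?\<Phi> *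
      (\<integral>\<^sup>+t. (\<integral>\<^sup>+y. ennreal ((cmod (?P y t))\<^sup>2 * W (y, t)) * indicator unit_cell y * indicator {0..1} t \<partial>lborel) \<partial>lborel)"
    by (rule nn_integral_cmult) measurable
  also have "(\<integral>\<^sup>+t. (\<integral>\<^sup>+y. ennreal ((cmod (?P y t))\<^sup>2 * W (y, t)) * indicator unit_cell y * indicator {0..1} t \<partial>lborel) \<partial>lborel)
      = poly_mass K a W"
    unfolding poly_mass_def nn_integral_cbox_eq_unit_cell by (intro nn_integral_cong) (auto simp: indicator_def)
  also have "norm2_sq ?\<Phi> = bump_mass TYPE('n)"
    unfolding bump_mass_eq
    by (rule plancherel[where B=1])
       (auto simp: bump_le_1 bump_integrable intro!: continuous_intros continuous_bump)
  finally have "bump_mass TYPE('n) * poly_mass K a W \<le> bump_mass TYPE('n) * R" using 1 by simp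
  then show ?thesis
    using bump_mass_finite[where 'n='n] bump_mass_pos[where 'n='n] by (simp add: ennreal_mult_le_mult_iff)
qed

end

section \<open>Transference for slowly varying weights\<close>
definition stein_admissible :: "'n::finite itself \<Rightarrow> real \<Rightarrow> ennreal \<Rightarrow> bool" where
  "stein_admissible d N C \<longleftrightarrow> (\<forall>(w :: (real ^ 'n) \<times> real \<Rightarrow> real) u\<^sub>0 g.
     weight w \<longrightarrow> has_fourier_transform u\<^sub>0 g \<longrightarrow> ess_supp g \<subseteq> cube N \<longrightarrow>
     weighted_mass g w \<le> C * (\<integral>\<^sup>+v. ennreal ((cmod (g v))\<^sup>2) * (SUP x. xray w x v) \<partial>lborel))"

definition mizohata_admissible :: "'n::finite itself \<Rightarrow> real \<Rightarrow> ennreal \<Rightarrow> bool" where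
  "mizohata_admissible d N C \<longleftrightarrow> (\<forall>(w :: (real ^ 'n) \<times> real \<Rightarrow> real) u\<^sub>0 g.
     weight w \<longrightarrow> has_fourier_transform u\<^sub>0 g \<longrightarrow> ess_supp g \<subseteq> cube N \<longrightarrow>
     weighted_mass g w \<le> C * (SUP (x, v) \<in> UNIV \<times> ess_supp g. xray w x v) * norm2_sq u\<^sub>0)"

lemma packets_has_fourier_transform:
  assumes "0 < \<epsilon>"
  shows "has_fourier_transform (inverse_fourier (packets \<epsilon> K a)) (packets \<epsilon> K a)"
    and "norm2_sq (inverse_fourier (packets \<epsilon> K a)) = norm2_sq (packets \<epsilon> K a)"
  by (rule has_fourier_transform_inverse_fourier plancherel,
      rule packets_integrable[OF assms], rule continuous_packets, rule packets_bounded)+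

text \<open>
  The hypothesis on the X-ray transform is a Harnack inequality in the velocity: it bounds the transform
  at every \<open>v\<close> near a lattice point \<open>k\<close> by a quantity \<open>S k\<close> that belongs to the torus, with a loss that
  disappears as \<open>v\<close> tends to \<open>k\<close>.
\<close>
context
  fixes W :: "(real ^ 'n) \<times> real \<Rightarrow> real" and K :: "(int ^ 'n) set" and a :: "int ^ 'n \<Rightarrow> complex"
    and B c N :: real and S :: "int ^ 'n \<Rightarrow> ennreal"
  assumes W_meas: "W \<in> borel_measurable borel" and W_nonneg: "\<And>p. 0 \<le> W p" and W_le: "\<And>p. W p \<le> B"
    and W_per: "\<And>x k t. W (x + vec_of_int k, t) = W (x, t)"
    and c: "c \<ge> 0"
    and xray_le: "\<And>x v k. xray (time_cut W) x v \<le> ennreal (exp (c * norm (v - vec_of_int k))) * S k"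
    and K: "finite K" and K_cube: "vec_of_int ` K \<subseteq> cube N"
begin

private lemma xray_near:
  assumes "norm (v - vec_of_int k) \<le> \<epsilon>"
  shows "xray (time_cut W) x v \<le> ennreal (exp (c * \<epsilon>)) * S k"
proof -
  have "exp (c * norm (v - vec_of_int k)) \<le> exp (c * \<epsilon>)"
    using assms c by (simp add: mult_left_mono)
  then have "ennreal (exp (c * norm (v - vec_of_int k))) * S k \<le> ennreal (exp (c * \<epsilon>)) * S k"
    by (intro mult_right_mono ennreal_leI) auto
  then show ?thesis
    by (rule order_trans[OF xray_le])
qed

lemma poly_mass_le_of_stein_admissible:
  assumes C: "stein_admissible TYPE('n) (N + 1) C"
  shows "poly_mass K a W \<le> C * (\<Sum>k\<in>K. ennreal ((cmod (a k))\<^sup>2) * S k)"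
proof (rule poly_mass_le_of_packets[OF W_meas W_nonneg W_per])
  fix \<epsilon> :: real assume \<epsilon>: "0 < \<epsilon>" "\<epsilon> \<le> 1 / 2"
  let ?g = "packets \<epsilon> K a"
  have "weighted_mass ?g (time_cut W)
      \<le> C * (\<integral>\<^sup>+v. ennreal ((cmod (?g v))\<^sup>2) * (SUP x. xray (time_cut W) x v) \<partial>lborel)"
    using C weight_time_cut[OF W_meas W_nonneg W_le] packets_has_fourier_transform(1)[OF \<epsilon>(1)]
      ess_supp_packets_cube[OF K \<epsilon> K_cube] unfolding stein_admissible_def by blast
  also have "(\<integral>\<^sup>+v. ennreal ((cmod (?g v))\<^sup>2) * (SUP x. xray (time_cut W) x v) \<partial>lborel)
      \<le> ennreal (\<epsilon> ^ CARD('n)) * bump_mass TYPE('n) * (\<Sum>k\<in>K. ennreal ((cmod (a k))\<^sup>2) * (ennreal (exp (c * \<epsilon>)) * S k))"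
    by (intro nn_integral_packets_le K \<epsilon> SUP_least xray_near)
  also have "C * \<dots> = ennreal (\<epsilon> ^ CARD('n)) * bump_mass TYPE('n) *
      (ennreal (exp (c * \<epsilon>)) * (C * (\<Sum>k\<in>K. ennreal ((cmod (a k))\<^sup>2) * S k)))"
    by (simp add: sum_distrib_left mult_ac)
  finally show "weighted_mass ?g (time_cut W) \<le> ennreal (\<epsilon> ^ CARD('n)) * bump_mass TYPE('n) *
      (ennreal (exp (c * \<epsilon>)) * (C * (\<Sum>k\<in>K. ennreal ((cmod (a k))\<^sup>2) * S k)))"
    by (simp add: mult_left_mono)
qed

lemma poly_mass_le_of_mizohata_admissible:
  assumes C: "mizohata_admissible TYPE('n) (N + 1) C"
  shows "poly_mass K a W \<le> C * (SUP k\<in>K. S k) * ennreal (\<Sum>k\<in>K. (cmod (a k))\<^sup>2)"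
proof (rule poly_mass_le_of_packets[OF W_meas W_nonneg W_per])
  fix \<epsilon> :: real assume \<epsilon>: "0 < \<epsilon>" "\<epsilon> \<le> 1 / 2"
  let ?g = "packets \<epsilon> K a"
  have "weighted_mass ?g (time_cut W)
      \<le> C * (SUP (x, v) \<in> UNIV \<times> ess_supp ?g. xray (time_cut W) x v) * norm2_sq (inverse_fourier ?g)"
    using C weight_time_cut[OF W_meas W_nonneg W_le] packets_has_fourier_transform(1)[OF \<epsilon>(1)]
      ess_supp_packets_cube[OF K \<epsilon> K_cube] unfolding mizohata_admissible_def by blast
  also have "\<dots> \<le> C * (ennreal (exp (c * \<epsilon>)) * (SUP k\<in>K. S k)) *
      (ennreal (\<epsilon> ^ CARD('n)) * bump_mass TYPE('n) * ennreal (\<Sum>k\<in>K. (cmod (a k))\<^sup>2))"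
  proof (intro mult_mono mult_left_mono)
    show "norm2_sq (inverse_fourier ?g)
        \<le> ennreal (\<epsilon> ^ CARD('n)) * bump_mass TYPE('n) * ennreal (\<Sum>k\<in>K. (cmod (a k))\<^sup>2)"
      using norm2_sq_packets_le[OF K \<epsilon>] packets_has_fourier_transform(2)[OF \<epsilon>(1), of K a] by simp
    show "(SUP (x, v) \<in> UNIV \<times> ess_supp ?g. xray (time_cut W) x v) \<le> ennreal (exp (c * \<epsilon>)) * (SUP k\<in>K. S k)"
    proof (rule SUP_least, clarify)
      fix x v assume "v \<in> ess_supp ?g"
      then obtain k where k: "k \<in> K" "norm (v - vec_of_int k) \<le> \<epsilon>"
        using ess_supp_packets[OF K \<epsilon>(1), of a] by (auto simp: dist_norm norm_minus_commute)
      have "xray (time_cut W) x v \<le> ennreal (exp (c * \<epsilon>)) * S k" by (rule xray_near[OF k(2)])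
      also have "\<dots> \<le> ennreal (exp (c * \<epsilon>)) * (SUP k\<in>K. S k)"
        by (intro mult_left_mono SUP_upper k) auto
      finally show "xray (time_cut W) x v \<le> ennreal (exp (c * \<epsilon>)) * (SUP k\<in>K. S k)" .
    qed
  qed auto
  finally show "weighted_mass ?g (time_cut W) \<le> ennreal (\<epsilon> ^ CARD('n)) * bump_mass TYPE('n) *
      (ennreal (exp (c * \<epsilon>)) * (C * (SUP k\<in>K. S k) * ennreal (\<Sum>k\<in>K. (cmod (a k))\<^sup>2)))"
    by (simp add: mult_ac)
qed

end

section \<open>Mollified weights\<close>

text \<open>
  A probability density whose logarithm is Lipschitz. This is the property that makes averages against it
  slowly varying; compactly supported and Gaussian kernels lack it.
\<close>
definition laplace_kernel :: "real ^ 'n \<Rightarrow> real" where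
  "laplace_kernel y = (\<Prod>b\<in>Basis. exp (- \<bar>y \<bullet> b\<bar>) / 2)"

lemma laplace_kernel_nonneg [simp]: "0 \<le> laplace_kernel y"
  by (simp add: laplace_kernel_def prod_nonneg)

lemma laplace_kernel_measurable [measurable]: "laplace_kernel \<in> borel_measurable borel"
  unfolding laplace_kernel_def[abs_def] by measurable

lemma nn_integral_laplace_kernel: "(\<integral>\<^sup>+(y :: real ^ 'n). ennreal (laplace_kernel y) \<partial>lborel) = 1"
proof -
  have half: "(\<integral>\<^sup>+x. ennreal (exp (- x)) * indicator {0..} x \<partial>lborel) = ennreal (0 - (- exp (- 0)))"
  proof (rule nn_integral_FTC_atLeast)
    show "((\<lambda>x::real. - exp (- x)) has_real_derivative exp (- x)) (at x)" for x
      by (auto intro!: derivative_eq_intros)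
    have "((\<lambda>x::real. exp (- x)) \<longlongrightarrow> 0) at_top"
      by (rule filterlim_compose[OF exp_at_bot]) (rule filterlim_uminus_at_bot_at_top)
    then show "((\<lambda>x::real. - exp (- x)) \<longlongrightarrow> 0) at_top"
      using tendsto_minus by fastforce
  qed auto
  have neg: "(\<integral>\<^sup>+x. ennreal (exp x) * indicator {..<0} x \<partial>lborel)
      = (\<integral>\<^sup>+x. ennreal (exp (- x)) * indicator {0<..} x \<partial>(lborel :: real measure))"
    by (subst nn_integral_real_affine[where c="-1" and t=0]) (auto intro!: nn_integral_cong split: split_indicator)
  also have "\<dots> = (\<integral>\<^sup>+x. ennreal (exp (- x)) * indicator {0..} x \<partial>lborel)"
    using AE_lborel_singleton[of "0::real"]
    by (intro nn_integral_cong_AE) (auto split: split_indicator)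
  finally have neg: "(\<integral>\<^sup>+x. ennreal (exp x) * indicator {..<0} x \<partial>lborel) = (1 :: ennreal)"
    using half by simp
  have "(\<integral>\<^sup>+(x::real). ennreal (exp (- \<bar>x\<bar>)) \<partial>lborel)
      = (\<integral>\<^sup>+x. ennreal (exp (- x)) * indicator {0..} x + ennreal (exp x) * indicator {..<0} x \<partial>lborel)"
    by (intro nn_integral_cong) (auto split: split_indicator)
  also have "\<dots> = 2" using half neg by (subst nn_integral_add) auto
  finally have "(\<integral>\<^sup>+(x::real). ennreal (exp (- \<bar>x\<bar>)) \<partial>lborel) = 2" .
  then have one: "(\<integral>\<^sup>+(x::real). ennreal (exp (- \<bar>x\<bar>) / 2) \<partial>lborel) = 1"
    by (simp add: divide_ennreal[symmetric] nn_integral_divide)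
  have "(\<integral>\<^sup>+(y :: real ^ 'n). ennreal (laplace_kernel y) \<partial>lborel)
      = (\<integral>\<^sup>+(y :: real ^ 'n). (\<Prod>b\<in>Basis. ennreal (exp (- \<bar>y \<bullet> b\<bar>) / 2)) \<partial>lborel)"
    unfolding laplace_kernel_def by (intro nn_integral_cong prod_ennreal[symmetric]) auto
  also have "\<dots> = 1"
    by (subst nn_integral_lborel_prod) (auto simp: one)
  finally show ?thesis .
qed

lemma laplace_kernel_harnack:
  fixes y h :: "real ^ 'n"
  shows "laplace_kernel (y - h) \<le> exp (CARD('n) * norm h) * laplace_kernel y"
proof -
  have "laplace_kernel (y - h) \<le> (\<Prod>b\<in>(Basis :: (real ^ 'n) set). exp (norm h) * (exp (- \<bar>y \<bullet> b\<bar>) / 2))"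
    unfolding laplace_kernel_def
  proof (intro prod_mono conjI)
    fix b :: "real ^ 'n" assume "b \<in> Basis"
    then have "\<bar>h \<bullet> b\<bar> \<le> norm h" by (rule Basis_le_norm)
    then have "- \<bar>(y - h) \<bullet> b\<bar> \<le> norm h + - \<bar>y \<bullet> b\<bar>"
      by (simp add: inner_diff_left)
    then have "exp (- \<bar>(y - h) \<bullet> b\<bar>) \<le> exp (norm h) * exp (- \<bar>y \<bullet> b\<bar>)"
      by (simp only: exp_add[symmetric] exp_le_cancel_iff)
    then show "exp (- \<bar>(y - h) \<bullet> b\<bar>) / 2 \<le> exp (norm h) * (exp (- \<bar>y \<bullet> b\<bar>) / 2)" by simp
  qed auto
  also have "\<dots> = exp (CARD('n) * norm h) * laplace_kernel y"
    unfolding laplace_kernel_def by (simp only: prod.distrib prod_constant DIM_cart DIM_real mult_1_right exp_of_nat_mult)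
  finally show ?thesis .
qed

text \<open>
  The weight truncated at height \<open>n\<close> and averaged in space at scale \<open>1 / (n + 1)\<close>. The truncation keeps the
  average finite at every point, so that \<^const>\<open>enn2real\<close> loses nothing.
\<close>
definition mollified :: "nat \<Rightarrow> ((real ^ 'n) \<times> real \<Rightarrow> real) \<Rightarrow> (real ^ 'n) \<times> real \<Rightarrow> real" where
  "mollified n w p = enn2real (\<integral>\<^sup>+y. ennreal (min (w (fst p - (1 / real (Suc n)) *\<^sub>R y, snd p)) (real n) * laplace_kernel y) \<partial>lborel)"

context
  fixes w :: "(real ^ 'n) \<times> real \<Rightarrow> real"
  assumes w_meas: "w \<in> borel_measurable borel" and w_nonneg: "\<And>p. 0 \<le> w p"
    and w_per: "\<And>x k t. w (x + vec_of_int k, t) = w (x, t)"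
begin

private lemma w_meas': "w \<in> borel_measurable (borel \<Otimes>\<^sub>M borel)"
  using w_meas by (simp add: borel_prod)

private abbreviation "r n \<equiv> 1 / real (Suc n)"

private lemma mollifier_le:
  "(\<integral>\<^sup>+y. ennreal (min (w (x - r n *\<^sub>R y, t)) (real n) * laplace_kernel y) \<partial>lborel) \<le> ennreal (real n)"
proof -
  note [measurable] = w_meas'
  have "(\<integral>\<^sup>+y. ennreal (min (w (x - r n *\<^sub>R y, t)) (real n) * laplace_kernel y) \<partial>lborel)
      \<le> (\<integral>\<^sup>+(y :: real ^ 'n). ennreal (real n) * ennreal (laplace_kernel y) \<partial>lborel)"
    by (intro nn_integral_mono) (auto simp: ennreal_mult[symmetric] intro!: ennreal_leI mult_right_mono)
  also have "\<dots> = ennreal (real n) * (\<integral>\<^sup>+(y :: real ^ 'n). ennreal (laplace_kernel y) \<partial>lborel)"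
    by (rule nn_integral_cmult) measurable
  also have "\<dots> = ennreal (real n)"
    by (simp only: nn_integral_laplace_kernel mult_1_right)
  finally show ?thesis .
qed

lemma ennreal_mollified:
  "ennreal (mollified n w (x, t)) = (\<integral>\<^sup>+y. ennreal (min (w (x - (1 / real (Suc n)) *\<^sub>R y, t)) (real n) * laplace_kernel y) \<partial>lborel)"
  unfolding mollified_def fst_conv snd_conv
  by (rule ennreal_enn2real) (rule le_less_trans[OF mollifier_le], simp)

lemma mollified_nonneg: "0 \<le> mollified n w p"
  by (simp add: mollified_def)

lemma mollified_le: "mollified n w p \<le> real n"
proof -
  note [measurable] = w_meas'
  obtain x t where p: "p = (x, t)" by (cases p)
  have "ennreal (mollified n w p) \<le> ennreal (real n)"
    unfolding p ennreal_mollified by (rule mollifier_le)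
  then show ?thesis by (subst (asm) ennreal_le_iff) auto
qed

lemma mollified_measurable: "mollified n w \<in> borel_measurable borel"
proof -
  note [measurable] = w_meas'
  have "mollified n w \<in> borel_measurable (borel \<Otimes>\<^sub>M borel)"
    unfolding mollified_def[abs_def] by measurable
  then show ?thesis by (simp add: borel_prod)
qed

lemma mollified_periodic: "mollified n w (x + vec_of_int k, t) = mollified n w (x, t)"
proof -
  note [measurable] = w_meas'
  have "w (x + vec_of_int k - r n *\<^sub>R y, t) = w (x - r n *\<^sub>R y, t)" for y
    using w_per[of "x - r n *\<^sub>R y" k t] by (simp add: algebra_simps)
  then show ?thesis by (simp add: mollified_def)
qed

text \<open>
  Translating the weight by \<open>h\<close> is translating the kernel by \<open>(n + 1) h\<close>, which costs at most an exponential
  factor.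
\<close>
lemma mollified_harnack:
  "mollified n w (x - h, t) \<le> exp (CARD('n) * real (Suc n) * norm h) * mollified n w (x, t)"
proof -
  note [measurable] = w_meas'
  let ?f = "\<lambda>x. min (w (x, t)) (real n)"
  let ?E = "exp (CARD('n) * real (Suc n) * norm h)"
  have "ennreal (mollified n w (x - h, t)) = (\<integral>\<^sup>+y. ennreal (?f (x - h - r n *\<^sub>R y) * laplace_kernel y) \<partial>lborel)"
    by (rule ennreal_mollified)
  also have "\<dots> = (\<integral>\<^sup>+y. ennreal (?f (x - h - r n *\<^sub>R (- (real (Suc n) *\<^sub>R h) + y)) * laplace_kernel (- (real (Suc n) *\<^sub>R h) + y)) \<partial>lborel)"
    by (rule nn_integral_lborel_shift[symmetric]) measurable
  also have "\<dots> \<le> (\<integral>\<^sup>+y. ennreal ?E * ennreal (?f (x - r n *\<^sub>R y) * laplace_kernel y) \<partial>lborel)"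
  proof (intro nn_integral_mono)
    fix y
    have 1: "x - h - r n *\<^sub>R (- (real (Suc n) *\<^sub>R h) + y) = x - r n *\<^sub>R y"
      by (simp add: scaleR_add_right scaleR_diff_right del: of_nat_Suc)
    have 2: "laplace_kernel (- (real (Suc n) *\<^sub>R h) + y) \<le> ?E * laplace_kernel y"
      using laplace_kernel_harnack[of y "real (Suc n) *\<^sub>R h"] by (simp add: mult.assoc del: of_nat_Suc)
    have "?f (x - r n *\<^sub>R y) * laplace_kernel (- (real (Suc n) *\<^sub>R h) + y) \<le> ?f (x - r n *\<^sub>R y) * (?E * laplace_kernel y)"
      by (rule mult_left_mono[OF 2]) (simp add: w_nonneg)
    then show "ennreal (?f (x - h - r n *\<^sub>R (- (real (Suc n) *\<^sub>R h) + y)) * laplace_kernel (- (real (Suc n) *\<^sub>R h) + y))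
        \<le> ennreal ?E * ennreal (?f (x - r n *\<^sub>R y) * laplace_kernel y)"
      unfolding 1 by (simp add: ennreal_mult''[symmetric] w_nonneg mult.left_commute ennreal_leI)
  qed
  also have "\<dots> = ennreal ?E * ennreal (mollified n w (x, t))"
    unfolding ennreal_mollified by (rule nn_integral_cmult) measurable
  finally show ?thesis
    by (simp add: ennreal_mult[symmetric] mollified_nonneg)
qed

text \<open>
  Two independent facts: for \<open>t\<close> in \<open>[0,1]\<close>, replacing \<open>v\<close> by \<open>k\<close> moves the point \<open>x - 2 t v\<close> by at most
  \<open>2 \<bar>v - k\<bar>\<close>, to which the Harnack inequality applies; and at \<open>v = k\<close> the transform of an average is an
  average of transforms of translates, none of which exceeds the supremum.
\<close>
lemma xray_mollified_le:
  "xray (time_cut (mollified n w)) x v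
    \<le> ennreal (exp (2 * real CARD('n) * real (Suc n) * norm (v - vec_of_int k))) * (SUP x. torus_xray w x k)"
proof -
  note [measurable] = w_meas'
  let ?E = "exp (2 * real CARD('n) * real (Suc n) * norm (v - vec_of_int k))"
  let ?k = "vec_of_int k :: real ^ 'n"
  have [measurable]: "mollified n w \<in> borel_measurable (borel \<Otimes>\<^sub>M borel)"
    using mollified_measurable by (simp add: borel_prod)
  have "xray (time_cut (mollified n w)) x v \<le> (\<integral>\<^sup>+t. ennreal ?E * (ennreal (mollified n w (x - (2 * t) *\<^sub>R ?k, t)) * indicator {0..1} t) \<partial>lborel)"
    unfolding xray_time_cut
  proof (intro nn_integral_mono)
    fix t :: real
    show "ennreal (mollified n w (x - (2 * t) *\<^sub>R v, t)) * indicator {0..1} t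
        \<le> ennreal ?E * (ennreal (mollified n w (x - (2 * t) *\<^sub>R ?k, t)) * indicator {0..1} t)"
    proof (cases "t \<in> {0..1}")
      case True
      let ?h = "(2 * t) *\<^sub>R (v - ?k)"
      have "mollified n w (x - (2 * t) *\<^sub>R v, t) = mollified n w ((x - (2 * t) *\<^sub>R ?k) - ?h, t)"
        by (simp add: scaleR_diff_right)
      also have "\<dots> \<le> exp (CARD('n) * real (Suc n) * norm ?h) * mollified n w (x - (2 * t) *\<^sub>R ?k, t)"
        by (rule mollified_harnack)
      also have "\<dots> \<le> ?E * mollified n w (x - (2 * t) *\<^sub>R ?k, t)"
      proof (intro mult_right_mono mollified_nonneg iffD2[OF exp_le_cancel_iff])
        have "norm ?h \<le> 2 * norm (v - ?k)" using True unfolding norm_scaleR by (intro mult_right_mono) auto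
        then have "real CARD('n) * real (Suc n) * norm ?h \<le> real CARD('n) * real (Suc n) * (2 * norm (v - ?k))"
          by (intro mult_left_mono) auto
        then show "real CARD('n) * real (Suc n) * norm ?h \<le> 2 * real CARD('n) * real (Suc n) * norm (v - ?k)"
          by (simp only: mult_ac)
      qed
      finally show ?thesis using True
        by (simp add: ennreal_mult[symmetric] mollified_nonneg ennreal_leI)
    qed simp
  qed
  also have "\<dots> = ennreal ?E * (\<integral>\<^sup>+t\<in>{0..1}. ennreal (mollified n w (x - (2 * t) *\<^sub>R ?k, t)) \<partial>lborel)"
    by (rule nn_integral_cmult) measurable
  also have "(\<integral>\<^sup>+t\<in>{0..1}. ennreal (mollified n w (x - (2 * t) *\<^sub>R ?k, t)) \<partial>lborel)
      \<le> (SUP x. torus_xray w x k)"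
  proof -
    have "(\<integral>\<^sup>+t\<in>{0..1}. ennreal (mollified n w (x - (2 * t) *\<^sub>R ?k, t)) \<partial>lborel)
        = (\<integral>\<^sup>+t. (\<integral>\<^sup>+y. ennreal (min (w (x - (2 * t) *\<^sub>R ?k - r n *\<^sub>R y, t)) (real n) * laplace_kernel y) * indicator {0..1} t \<partial>lborel) \<partial>lborel)"
      unfolding ennreal_mollified by (intro nn_integral_cong nn_integral_multc[symmetric]) measurable
    also have "\<dots> = (\<integral>\<^sup>+y. (\<integral>\<^sup>+t. ennreal (min (w (x - (2 * t) *\<^sub>R ?k - r n *\<^sub>R y, t)) (real n) * laplace_kernel y) * indicator {0..1} t \<partial>lborel) \<partial>lborel)"
      by (rule lborel_pair.Fubini') measurable
    also have "\<dots> \<le> (\<integral>\<^sup>+(y :: real ^ 'n). ennreal (laplace_kernel y) * (SUP x. torus_xray w x k) \<partial>lborel)"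
    proof (intro nn_integral_mono)
      fix y
      have "(\<integral>\<^sup>+t. ennreal (min (w (x - (2 * t) *\<^sub>R ?k - r n *\<^sub>R y, t)) (real n) * laplace_kernel y) * indicator {0..1} t \<partial>lborel)
          \<le> (\<integral>\<^sup>+t. ennreal (laplace_kernel y) * (ennreal (w (x - r n *\<^sub>R y - (2 * t) *\<^sub>R ?k, t)) * indicator {0..1} t) \<partial>lborel)"
      proof (intro nn_integral_mono)
        fix t :: real
        have "x - (2 * t) *\<^sub>R ?k - r n *\<^sub>R y = x - r n *\<^sub>R y - (2 * t) *\<^sub>R ?k" by (simp add: algebra_simps)
        moreover have "min (w z) (real n) * laplace_kernel y \<le> laplace_kernel y * w z" for z
          by (subst mult.commute) (intro mult_left_mono, auto)
        ultimately have "min (w (x - (2 * t) *\<^sub>R ?k - r n *\<^sub>R y, t)) (real n) * laplace_kernel y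
            \<le> laplace_kernel y * w (x - r n *\<^sub>R y - (2 * t) *\<^sub>R ?k, t)"
          by (simp only:)
        then show "ennreal (min (w (x - (2 * t) *\<^sub>R ?k - r n *\<^sub>R y, t)) (real n) * laplace_kernel y) * indicator {0..1} t
          \<le> ennreal (laplace_kernel y) * (ennreal (w (x - r n *\<^sub>R y - (2 * t) *\<^sub>R ?k, t)) * indicator {0..1} t)"
          by (simp add: ennreal_mult[symmetric] w_nonneg ennreal_leI indicator_def del: of_nat_Suc)
      qed
      also have "\<dots> = ennreal (laplace_kernel y) * torus_xray w (x - r n *\<^sub>R y) k"
        unfolding torus_xray_def by (rule nn_integral_cmult) measurable
      also have "\<dots> \<le> ennreal (laplace_kernel y) * (SUP x. torus_xray w x k)"
        by (intro mult_left_mono SUP_upper) auto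
      finally show "(\<integral>\<^sup>+t. ennreal (min (w (x - (2 * t) *\<^sub>R ?k - r n *\<^sub>R y, t)) (real n) * laplace_kernel y) * indicator {0..1} t \<partial>lborel)
        \<le> ennreal (laplace_kernel y) * (SUP x. torus_xray w x k)" .
    qed
    also have "\<dots> = (SUP x. torus_xray w x k)"
      by (simp add: nn_integral_multc nn_integral_laplace_kernel)
    finally show ?thesis .
  qed
  finally show ?thesis by (simp add: mult_left_mono)
qed

text \<open>
  By periodicity the average moves from the weight to the solution. The solution is continuous, so its
  translates converge at every point, whereas averages of a rough weight converge only almost
  everywhere.
\<close>
lemma poly_mass_mollified:
  "poly_mass K a (mollified n w) = (\<integral>\<^sup>+t. (\<integral>\<^sup>+y. (\<integral>\<^sup>+x.
     ennreal ((cmod (schroedinger_poly K a (r n *\<^sub>R y + x) t))\<^sup>2 * (min (w (x, t)) (real n) * laplace_kernel y))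
       * indicator (cbox 0 1) x * indicator {0..1} t \<partial>lborel) \<partial>lborel) \<partial>lborel)"
proof -
  note [measurable] = w_meas'
  let ?P = "schroedinger_poly K a"
  have "(\<integral>\<^sup>+x\<in>cbox 0 1. ennreal ((cmod (?P x t))\<^sup>2 * mollified n w (x, t)) \<partial>lborel)
      = (\<integral>\<^sup>+y. (\<integral>\<^sup>+x\<in>cbox 0 1. ennreal ((cmod (?P (r n *\<^sub>R y + x) t))\<^sup>2 * (min (w (x, t)) (real n) * laplace_kernel y)) \<partial>lborel) \<partial>lborel)" for t
  proof -
    let ?f = "\<lambda>x. min (w (x, t)) (real n)"
    have "(\<integral>\<^sup>+x\<in>cbox 0 1. ennreal ((cmod (?P x t))\<^sup>2 * mollified n w (x, t)) \<partial>lborel)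
        = (\<integral>\<^sup>+x. (\<integral>\<^sup>+y. ennreal ((cmod (?P x t))\<^sup>2 * (?f (x - r n *\<^sub>R y) * laplace_kernel y)) * indicator (cbox 0 1) x \<partial>lborel) \<partial>lborel)"
    proof (intro nn_integral_cong)
      fix x
      have "ennreal ((cmod (?P x t))\<^sup>2 * mollified n w (x, t))
          = (\<integral>\<^sup>+y. ennreal ((cmod (?P x t))\<^sup>2) * ennreal (?f (x - r n *\<^sub>R y) * laplace_kernel y) \<partial>lborel)"
        by (subst nn_integral_cmult) (auto simp: ennreal_mult mollified_nonneg ennreal_mollified)
      also have "\<dots> = (\<integral>\<^sup>+y. ennreal ((cmod (?P x t))\<^sup>2 * (?f (x - r n *\<^sub>R y) * laplace_kernel y)) \<partial>lborel)"
        by (intro nn_integral_cong ennreal_mult[symmetric]) (auto simp: w_nonneg)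
      finally show "ennreal ((cmod (?P x t))\<^sup>2 * mollified n w (x, t)) * indicator (cbox 0 1) x
          = (\<integral>\<^sup>+y. ennreal ((cmod (?P x t))\<^sup>2 * (?f (x - r n *\<^sub>R y) * laplace_kernel y)) * indicator (cbox 0 1) x \<partial>lborel)"
        by (simp add: indicator_def)
    qed
    also have "\<dots> = (\<integral>\<^sup>+y. (\<integral>\<^sup>+x\<in>cbox 0 1. ennreal ((cmod (?P x t))\<^sup>2 * (?f (x - r n *\<^sub>R y) * laplace_kernel y)) \<partial>lborel) \<partial>lborel)"
      by (rule lborel_pair.Fubini') measurable
    also have "\<dots> = (\<integral>\<^sup>+y. (\<integral>\<^sup>+x\<in>cbox 0 1. ennreal ((cmod (?P (r n *\<^sub>R y + x) t))\<^sup>2 * (?f x * laplace_kernel y)) \<partial>lborel) \<partial>lborel)"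
    proof (rule nn_integral_cong)
      fix y
      have [simp]: "w (x + vec_of_int k - z, t) = w (x - z, t)" for x k z
        using w_per[of "x - z" k t] by (simp add: algebra_simps)
      show "(\<integral>\<^sup>+x\<in>cbox 0 1. ennreal ((cmod (?P x t))\<^sup>2 * (?f (x - r n *\<^sub>R y) * laplace_kernel y)) \<partial>lborel)
          = (\<integral>\<^sup>+x\<in>cbox 0 1. ennreal ((cmod (?P (r n *\<^sub>R y + x) t))\<^sup>2 * (?f x * laplace_kernel y)) \<partial>lborel)"
        using nn_integral_periodic_shift[of "\<lambda>x. ennreal ((cmod (?P x t))\<^sup>2 * (?f (x - r n *\<^sub>R y) * laplace_kernel y))" "r n *\<^sub>R y", symmetric]
        by (simp add: schroedinger_poly_periodic del: of_nat_Suc)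
    qed
    finally show ?thesis .
  qed
  then show ?thesis
    unfolding poly_mass_def by (intro nn_integral_cong) (auto simp: indicator_def)
qed

lemma poly_mass_le_liminf_mollified:
  "poly_mass K a w \<le> liminf (\<lambda>n. poly_mass K a (mollified n w))"
proof -
  note [measurable] = w_meas'
  let ?P = "schroedinger_poly K a"
  let ?F = "\<lambda>n t y x. ennreal ((cmod (?P (r n *\<^sub>R y + x) t))\<^sup>2 * (min (w (x, t)) (real n) * laplace_kernel y))
       * indicator (cbox 0 1) x * indicator {0..1} t"
  let ?G = "\<lambda>t (y :: real ^ 'n) x. ennreal (laplace_kernel y) * (ennreal ((cmod (?P x t))\<^sup>2 * w (x, t)) * indicator (cbox 0 1) x * indicator {0..1} t)"
  have ptw: "?G t y x \<le> liminf (\<lambda>n. ?F n t y x)" for t y x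
  proof -
    let ?I = "indicator (cbox 0 1) x * indicator {0..1} t :: ennreal"
    have "continuous_on UNIV (\<lambda>x. ?P x t)"
      unfolding schroedinger_poly_def by (intro continuous_intros)
    then have "isCont (\<lambda>x. ?P x t) x" by (simp add: continuous_on_eq_continuous_at)
    moreover have "(\<lambda>n. r n *\<^sub>R y + x) \<longlonglongrightarrow> 0 *\<^sub>R y + x"
      using LIMSEQ_inverse_real_of_nat by (intro tendsto_intros) (simp add: inverse_eq_divide)
    ultimately have 1: "(\<lambda>n. ?P (r n *\<^sub>R y + x) t) \<longlonglongrightarrow> ?P x t"
      using isCont_tendsto_compose[of x "\<lambda>x. ?P x t"] by simp
    have "\<forall>\<^sub>F n in sequentially. min (w (x, t)) (real n) = w (x, t)"
      using eventually_ge_at_top[of "nat \<lceil>w (x, t)\<rceil>"] by eventually_elim linarith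
    then have 2: "(\<lambda>n. min (w (x, t)) (real n)) \<longlonglongrightarrow> w (x, t)" by (rule tendsto_eventually)
    have "(\<lambda>n. (cmod (?P (r n *\<^sub>R y + x) t))\<^sup>2 * (min (w (x, t)) (real n) * laplace_kernel y))
        \<longlonglongrightarrow> (cmod (?P x t))\<^sup>2 * (w (x, t) * laplace_kernel y)"
      by (intro tendsto_intros 1 2)
    from tendsto_ennrealI[OF this]
    have "(\<lambda>n. ennreal ((cmod (?P (r n *\<^sub>R y + x) t))\<^sup>2 * (min (w (x, t)) (real n) * laplace_kernel y)) * ?I)
        \<longlonglongrightarrow> ennreal ((cmod (?P x t))\<^sup>2 * (w (x, t) * laplace_kernel y)) * ?I"
      by (intro tendsto_mult_ennreal tendsto_const) (auto simp: indicator_def)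
    moreover have "ennreal ((cmod (?P x t))\<^sup>2 * (w (x, t) * laplace_kernel y)) * ?I = ?G t y x"
      by (simp add: ennreal_mult w_nonneg mult_ac)
    ultimately have "(\<lambda>n. ?F n t y x) \<longlonglongrightarrow> ?G t y x" by (simp add: mult.assoc del: of_nat_Suc)
    from lim_imp_Liminf[OF _ this] show ?thesis by simp
  qed
  have "(\<integral>\<^sup>+x. ?G t y x \<partial>lborel) \<le> liminf (\<lambda>n. \<integral>\<^sup>+x. ?F n t y x \<partial>lborel)" for t y
    by (rule nn_integral_le_liminf[OF _ ptw]) measurable
  then have "(\<integral>\<^sup>+y. (\<integral>\<^sup>+x. ?G t y x \<partial>lborel) \<partial>lborel)
      \<le> liminf (\<lambda>n. \<integral>\<^sup>+y. (\<integral>\<^sup>+x. ?F n t y x \<partial>lborel) \<partial>lborel)" for t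
    by (rule nn_integral_le_liminf[rotated]) measurable
  then have "(\<integral>\<^sup>+t. (\<integral>\<^sup>+y. (\<integral>\<^sup>+x. ?G t y x \<partial>lborel) \<partial>lborel) \<partial>lborel)
      \<le> liminf (\<lambda>n. \<integral>\<^sup>+t. (\<integral>\<^sup>+y. (\<integral>\<^sup>+x. ?F n t y x \<partial>lborel) \<partial>lborel) \<partial>lborel)"
    by (rule nn_integral_le_liminf[rotated]) measurable
  also have "\<dots> = liminf (\<lambda>n. poly_mass K a (mollified n w))"
    by (simp only: poly_mass_mollified)
  finally have "(\<integral>\<^sup>+t. (\<integral>\<^sup>+y. (\<integral>\<^sup>+x. ?G t y x \<partial>lborel) \<partial>lborel) \<partial>lborel)
      \<le> liminf (\<lambda>n. poly_mass K a (mollified n w))" .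
  also have "(\<integral>\<^sup>+t. (\<integral>\<^sup>+y. (\<integral>\<^sup>+x. ?G t y x \<partial>lborel) \<partial>lborel) \<partial>lborel)
      = (\<integral>\<^sup>+t. (\<integral>\<^sup>+(y :: real ^ 'n). ennreal (laplace_kernel y) * (\<integral>\<^sup>+x. ennreal ((cmod (?P x t))\<^sup>2 * w (x, t)) * indicator (cbox 0 1) x * indicator {0..1} t \<partial>lborel) \<partial>lborel) \<partial>lborel)"
    by (intro nn_integral_cong nn_integral_cmult) measurable
  also have "\<dots> = poly_mass K a w"
    unfolding poly_mass_def
    by (intro nn_integral_cong) (auto simp: nn_integral_multc nn_integral_laplace_kernel indicator_def)
  finally show ?thesis .
qed

end

section \<open>Transference for all weights\<close>
lemma poly_mass_le_of_mollified:
  fixes w :: "(real ^ 'n) \<times> real \<Rightarrow> real"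
  assumes w: "torus_weight w" and bound: "\<And>n. poly_mass K a (mollified n w) \<le> R"
  shows "poly_mass K a w \<le> R"
proof -
  have per: "w (x + vec_of_int k, t) = w (x, t)" for x k t
    using w[unfolded torus_weight_def] by (metis add.right_neutral of_int_0)
  have "poly_mass K a w \<le> liminf (\<lambda>n. poly_mass K a (mollified n w))"
    using w per by (intro poly_mass_le_liminf_mollified) (auto simp: torus_weight_def weight_def)
  also have "\<dots> \<le> R"
    using bound by (intro Liminf_le always_eventually) auto
  finally show ?thesis .
qed

lemma torus_weighted_mass_eq:
  "trig_poly u \<Longrightarrow> torus_weighted_mass u w = poly_mass (fourier_supp u) (fourier_coeff u) w"
  by (simp add: torus_weighted_mass_def poly_mass_def torus_solution_eq)

lemma torus_stein_of_stein_admissible: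
  fixes w :: "(real ^ 'n) \<times> real \<Rightarrow> real"
  assumes C: "stein_admissible TYPE('n) (N + 1) C" and w: "torus_weight w" and u: "trig_poly u"
    and N: "vec_of_int ` fourier_supp u \<subseteq> cube N"
  shows "torus_weighted_mass u w
       \<le> C * (\<Sum>\<^sub>\<infinity>k. ennreal ((cmod (fourier_coeff u k))\<^sup>2) * (SUP x. torus_xray w x k))"
proof -
  let ?K = "fourier_supp u" and ?a = "fourier_coeff u" and ?S = "\<lambda>k. SUP x. torus_xray w x k"
  have fin: "finite ?K" by (rule finite_fourier_supp[OF u])
  have wm: "w \<in> borel_measurable borel" and wn: "\<And>p. 0 \<le> w p"
    using w by (auto simp: torus_weight_def weight_def)
  have per: "w (x + vec_of_int k, t) = w (x, t)" for x k t
    using w[unfolded torus_weight_def] by (metis add.right_neutral of_int_0)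
  have "poly_mass ?K ?a w \<le> C * (\<Sum>k\<in>?K. ennreal ((cmod (?a k))\<^sup>2) * ?S k)"
  proof (rule poly_mass_le_of_mollified[OF w])
    fix n
    show "poly_mass ?K ?a (mollified n w) \<le> C * (\<Sum>k\<in>?K. ennreal ((cmod (?a k))\<^sup>2) * ?S k)"
      by (rule poly_mass_le_of_stein_admissible[OF mollified_measurable[OF wm wn per] mollified_nonneg[OF wm wn per]
            mollified_le[OF wm wn per] mollified_periodic[OF wm wn per] _ xray_mollified_le[OF wm wn per] fin N C]) auto
  qed
  also have "(\<Sum>k\<in>?K. ennreal ((cmod (?a k))\<^sup>2) * ?S k) = (\<Sum>\<^sub>\<infinity>k\<in>?K. ennreal ((cmod (?a k))\<^sup>2) * ?S k)"
    using fin by simp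
  also have "\<dots> = (\<Sum>\<^sub>\<infinity>k. ennreal ((cmod (?a k))\<^sup>2) * ?S k)"
    by (rule infsum_cong_neutral) (auto simp: fourier_supp_def)
  finally show ?thesis by (simp add: torus_weighted_mass_eq[OF u])
qed

lemma torus_mizohata_of_mizohata_admissible:
  fixes w :: "(real ^ 'n) \<times> real \<Rightarrow> real"
  assumes C: "mizohata_admissible TYPE('n) (N + 1) C" and w: "torus_weight w" and u: "trig_poly u"
    and N: "vec_of_int ` fourier_supp u \<subseteq> cube N"
  shows "torus_weighted_mass u w
       \<le> C * (SUP (x, k) \<in> UNIV \<times> fourier_supp u. torus_xray w x k) * torus_norm2_sq u"
proof -
  let ?K = "fourier_supp u" and ?a = "fourier_coeff u" and ?S = "\<lambda>k. SUP x. torus_xray w x k"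
  have fin: "finite ?K" by (rule finite_fourier_supp[OF u])
  have wm: "w \<in> borel_measurable borel" and wn: "\<And>p. 0 \<le> w p"
    using w by (auto simp: torus_weight_def weight_def)
  have per: "w (x + vec_of_int k, t) = w (x, t)" for x k t
    using w[unfolded torus_weight_def] by (metis add.right_neutral of_int_0)
  have "poly_mass ?K ?a w \<le> C * (SUP k\<in>?K. ?S k) * ennreal (\<Sum>k\<in>?K. (cmod (?a k))\<^sup>2)"
  proof (rule poly_mass_le_of_mollified[OF w])
    fix n
    show "poly_mass ?K ?a (mollified n w) \<le> C * (SUP k\<in>?K. ?S k) * ennreal (\<Sum>k\<in>?K. (cmod (?a k))\<^sup>2)"
      by (rule poly_mass_le_of_mizohata_admissible[OF mollified_measurable[OF wm wn per] mollified_nonneg[OF wm wn per]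
            mollified_le[OF wm wn per] mollified_periodic[OF wm wn per] _ xray_mollified_le[OF wm wn per] fin N C]) auto
  qed
  also have "(SUP k\<in>?K. ?S k) = (SUP (x, k) \<in> UNIV \<times> ?K. torus_xray w x k)"
  proof (intro antisym SUP_least)
    show "torus_xray w x k \<le> (SUP (x, k) \<in> UNIV \<times> ?K. torus_xray w x k)" if "k \<in> ?K" for x k
      using SUP_upper[of "(x, k)" "UNIV \<times> ?K" "\<lambda>(x, k). torus_xray w x k"] that by simp
    show "(case p of (x, k) \<Rightarrow> torus_xray w x k) \<le> (SUP k\<in>?K. ?S k)" if "p \<in> UNIV \<times> ?K" for p
      using that by (auto intro!: SUP_upper2[of "snd p"] SUP_upper2[of "fst p"])
  qed
  finally show ?thesis by (simp add: torus_weighted_mass_eq[OF u] torus_parseval[OF u])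
qed

theorem theorem1p3:
  fixes N :: real
  assumes "N \<ge> 1"
  shows "torus_stein_const TYPE('n::finite) N \<le> stein_const TYPE('n) (N + 1) \<and>
         torus_mizohata_const TYPE('n) N \<le> mizohata_const TYPE('n) (N + 1)"
proof
  show "torus_stein_const TYPE('n) N \<le> stein_const TYPE('n) (N + 1)"
    unfolding torus_stein_const_def stein_const_def stein_admissible_def[of "TYPE('n)", symmetric]
    by (intro Inf_superset_mono) (auto intro!: torus_stein_of_stein_admissible)
  show "torus_mizohata_const TYPE('n) N \<le> mizohata_const TYPE('n) (N + 1)"
    unfolding torus_mizohata_const_def mizohata_const_def mizohata_admissible_def[of "TYPE('n)", symmetric]
    by (intro Inf_superset_mono) (auto intro!: torus_mizohata_of_mizohata_admissible)
qed

end
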